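(* Let $p\ge 3$ be real and let $d\ge 2$. There exist a compact convex $p$-uniformly convex set $\mathcal C\subset\mathbb R^d$, a smooth and strongly convex function $f:\mathcal C\to\mathbb R$ with minimizer $x^*\in\arg\min_{x\in\mathcal C}f(x)$, and an initial point $x_0\in\mathcal C$ such that the Frank--Wolfe algorithm with exact line search on $\min_{x\in\mathcal C}f(x)$ started at $x_0$ generates iterates $(x_t)_{t\ge 0}$ satisfying $$f(x_T)-f(x^* )\;\sim\;\left(\frac{p+1}{p}\right)^2\left(\frac{p}{4(p-1)}\right)^{p/(p-1)}T^{-p/(p-1)}\qquad\text{as }T\to\infty.$$ In particular, $f(x_T)-f(x^* )=\Omega\left(T^{-p/(p-1)}\right)$, i.e. there is a constant $c>0$ with $f(x_T)-f(x^* )\ge c\,T^{-p/(p-1)}$ for all $T\ge 1$.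
   Context: $\|\cdot\|$ denotes the Euclidean norm on $\mathbb R^d$. The notation $a_T\sim b_T$ means $a_T/b_T\to 1$ as $T\to\infty$. Uniformly convex set: let $\mathcal C\subset\mathbb R^d$ be closed and $\gamma_{\mathcal C}:\mathbb R_+\to\mathbb R_+$ nondecreasing. $\mathcal C$ is $\gamma_{\mathcal C}$-uniformly convex (with respect to $\|\cdot\|$) if for all $x,y\in\mathcal C$, all $\eta\in[0,1]$ and all $z\in\mathbb R^d$ with $\|z\|=1$, $\eta x+(1-\eta)y+\eta(1-\eta)\gamma_{\mathcal C}(\|x-y\|)z\in\mathcal C$. If there exist $\alpha>0$ and $q\ge2$ with $\gamma_{\mathcal C}(r)\ge\alpha r^q$ for all $r\ge0$, then $\mathcal C$ is called $q$-uniformly convex. A differentiable function $f$ is $\mu$-strongly convex if $f(x)\ge f(y)+\langle\nabla f(y),x-y\rangle+\frac{\mu}{2}\|x-y\|^2$ and $L$-smooth if $f(x)\le f(y)+\langle\nabla f(y),x-y\rangle+\frac L2\|x-y\|^2$, for all $x,y$ in its domain; it is called strongly convex (smooth) if this holds for some $\mu>0$ ($L>0$). For $f$ on $\mathcal C$, differentiability is understood as differentiability on an open neighbourhood of $\mathcal C$. Frank--Wolfe with exact line search: from $x_0\in\mathcal C$, for $t=0,1,2,\dots$: choose $v_t\in\arg\min_{v\in\mathcal C}\langle\nabla f(x_t),v\rangle$; choose $\gamma_t\in\arg\min_{\gamma\in[0,1]}f(x_t+\gamma(v_t-x_t))$; set $x_{t+1}=x_t+\gamma_t(v_t-x_t)$.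 *)

theory Defs
  imports "HOL-Analysis.Analysis" "HOL-Library.Landau_Symbols"
begin

definition uniformly_convex_set :: "(real \<Rightarrow> real) \<Rightarrow> 'a::real_normed_vector set \<Rightarrow> bool" where
  "uniformly_convex_set \<gamma> C \<longleftrightarrow>
     closed C \<and> (\<forall>r\<ge>0. \<gamma> r \<ge> 0) \<and> mono_on {0..} \<gamma> \<and>
     (\<forall>x\<in>C. \<forall>y\<in>C. \<forall>\<eta>\<in>{0..1}. \<forall>z. norm z = 1 \<longrightarrow>
        \<eta> *\<^sub>R x + (1 - \<eta>) *\<^sub>R y + (\<eta> * (1 - \<eta>) * \<gamma> (norm (x - y))) *\<^sub>R z \<in> C)"

text \<open>Since \<open>0 powr q = 0\<close> for \<open>q \<noteq> 0\<close>, the lower bound at \<open>r = 0\<close> is the intended one.\<close>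

definition power_uniformly_convex_set :: "real \<Rightarrow> 'a::real_normed_vector set \<Rightarrow> bool" where
  "power_uniformly_convex_set q C \<longleftrightarrow>
     q \<ge> 2 \<and>
     (\<exists>\<gamma> \<alpha>. \<alpha> > 0 \<and> uniformly_convex_set \<gamma> C \<and> (\<forall>r\<ge>0. \<gamma> r \<ge> \<alpha> * r powr q))"

definition gradient :: "('a::real_inner \<Rightarrow> real) \<Rightarrow> 'a \<Rightarrow> 'a" where
  "gradient f x = (THE g. GDERIV f x :> g)"

lemma gradient_eqI:
  assumes "GDERIV f x :> g"
  shows "gradient f x = g"
  unfolding gradient_def
proof (rule the_equality, rule assms)
  fix h assume "GDERIV f x :> h"
  then have "(\<lambda>v. inner v h) = (\<lambda>v. inner v g)"
    using assms unfolding gderiv_def by (rule has_derivative_unique)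
  then have "\<forall>v. inner v h = inner v g" by meson
  then show "h = g" by (metis inner_commute vector_eq_ldot)
qed

lemma differentiable_imp_GDERIV_gradient:
  fixes f :: "'a::euclidean_space \<Rightarrow> real"
  assumes "f differentiable (at x)"
  shows "GDERIV f x :> gradient f x"
proof -
  obtain D where D: "(f has_derivative D) (at x)"
    using assms by (auto simp: differentiable_def)
  have "D = (\<lambda>h. inner h (adjoint D 1))"
    using adjoint_works[OF has_derivative_linear[OF D], of _ 1] by (simp add: fun_eq_iff)
  then have "GDERIV f x :> adjoint D 1"
    using D by (simp add: gderiv_def)
  then show ?thesis by (simp add: gradient_eqI)
qed

definition differentiable_near :: "'a::real_normed_vector set \<Rightarrow> ('a \<Rightarrow> real) \<Rightarrow> bool" where
  "differentiable_near C f \<longleftrightarrow>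
     (\<exists>U. open U \<and> C \<subseteq> U \<and> (\<forall>x\<in>U. f differentiable (at x)))"

definition strongly_convex_fun_on :: "'a::real_inner set \<Rightarrow> ('a \<Rightarrow> real) \<Rightarrow> bool" where
  "strongly_convex_fun_on C f \<longleftrightarrow>
     differentiable_near C f \<and>
     (\<exists>\<mu>>0. \<forall>x\<in>C. \<forall>y\<in>C.
        f x \<ge> f y + inner (gradient f y) (x - y) + \<mu> / 2 * (norm (x - y))\<^sup>2)"

definition smooth_fun_on :: "'a::real_inner set \<Rightarrow> ('a \<Rightarrow> real) \<Rightarrow> bool" where
  "smooth_fun_on C f \<longleftrightarrow>
     differentiable_near C f \<and>
     (\<exists>L>0. \<forall>x\<in>C. \<forall>y\<in>C.
        f x \<le> f y + inner (gradient f y) (x - y) + L / 2 * (norm (x - y))\<^sup>2)"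

text \<open>The choices in each step need not be unique, so the algorithm is rendered as the
  predicate \<open>x is a sequence of iterates of some run started at x0\<close>.\<close>

definition frank_wolfe_line_search ::
    "'a::real_inner set \<Rightarrow> ('a \<Rightarrow> real) \<Rightarrow> 'a \<Rightarrow> (nat \<Rightarrow> 'a) \<Rightarrow> bool" where
  "frank_wolfe_line_search C f x0 x \<longleftrightarrow>
     x 0 = x0 \<and>
     (\<exists>(v :: nat \<Rightarrow> 'a) (\<gamma> :: nat \<Rightarrow> real). \<forall>t.
        is_arg_min (\<lambda>w. inner (gradient f (x t)) w) (\<lambda>w. w \<in> C) (v t) \<and>
        is_arg_min (\<lambda>s. f (x t + s *\<^sub>R (v t - x t))) (\<lambda>s. s \<in> {0..1}) (\<gamma> t) \<and>
        x (Suc t) = x t + \<gamma> t *\<^sub>R (v t - x t))"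

end

theory Submission
  imports Defs "HOL-Real_Asymp.Real_Asymp"
begin

text \<open>
  The objective is \<open>f z = K * (norm z)\<^sup>2\<close>. It attains its minimum at the origin, which is a
  boundary point of \<open>C\<close>, and everything happens in the plane of two coordinates. Near the
  origin \<open>C\<close> is comparable to the epigraph of a multiple of \<open>\<bar>x\<bar>\<^sup>p\<close>. The iterates zigzag: if
  \<open>x\<^sub>t\<close> is a multiple \<open>\<xi>\<^sub>t\<close> of the vector \<open>N\<^sub>t = (\<plusminus> m\<^sub>t, 1)\<close>, slightly to one side of the axis,
  then the linear minimization selects a boundary point \<open>v\<^sub>t = (\<minusplus> u\<^sub>t, w\<^sub>t)\<close> on the other side,
  and the line search returns the foot of the perpendicular from the origin to the line through
  \<open>x\<^sub>t\<close> and \<open>v\<^sub>t\<close>. That foot is again of the form \<open>\<xi>\<^sub>t\<^sub>+\<^sub>1 * N\<^sub>t\<^sub>+\<^sub>1\<close> with the opposite sign. Let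
  \<open>\<eta>\<^sub>t\<close> be the height at which the line crosses the axis. Both points lie on the line, so
  \<open>u\<^sub>t * m\<^sub>t\<^sub>+\<^sub>1 + w\<^sub>t = \<eta>\<^sub>t\<close>, while
  \<open>\<xi>\<^sub>t\<^sub>+\<^sub>1 = \<xi>\<^sub>t * (1 - m\<^sub>t * m\<^sub>t\<^sub>+\<^sub>1) / (1 + m\<^sub>t\<^sub>+\<^sub>1\<^sup>2)\<close>.

  The construction reads these equations backwards. The slopes are prescribed as
  \<open>m\<^sub>t = sqrt (k / (t + N))\<close>, so \<open>\<xi>\<^sub>t\<close> is an explicit product of order \<open>t powr (- 2 * k)\<close>, and
  \<open>k = p / (4 * (p - 1))\<close> gives the exponent of the theorem; the constant is then adjusted by the
  factor \<open>K\<close>. Next the vertices \<open>v\<^sub>t\<close> are chosen on the prescribed lines, and \<open>C\<close> is built around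
  them so that its supporting line with normal \<open>N\<^sub>t\<close> touches it at \<open>v\<^sub>t\<close>.
  Because the orbit is exact, no stability of the iteration has to be shown.

  For the set, let \<open>C\<close> be the intersection of the caps
  \<open>{z. c * norm (z - v\<^sub>t) powr p \<le> inner N\<^sub>t (z - v\<^sub>t)}\<close>. Each cap is \<open>p\<close>-uniformly convex with
  constants depending on \<open>p\<close> and \<open>c\<close> only, so \<open>C\<close> is \<open>p\<close>-uniformly convex as well
  (\<open>power_uniformly_convex_INT_power_cap\<close>), and the cap with vertex \<open>v\<^sub>t\<close> makes \<open>v\<^sub>t\<close> the only
  minimizer of \<open>inner N\<^sub>t\<close> over \<open>C\<close>, as soon as all vertices lie in all caps
  (\<open>exists_zigzag_set\<close>). This last condition says that the points \<open>(u\<^sub>t, w\<^sub>t)\<close> lie on a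
  \<open>p\<close>-uniformly convex graph with subgradients \<open>m\<^sub>t\<close>. It reduces to consecutive points: the slope
  of the chord from \<open>(u\<^sub>t, w\<^sub>t)\<close> to \<open>(u\<^sub>t\<^sub>+\<^sub>1, w\<^sub>t\<^sub>+\<^sub>1)\<close> has to lie between \<open>m\<^sub>t\<^sub>+\<^sub>1\<close> and \<open>m\<^sub>t\<close>, with a margin of the
  order of their difference.

  The one free parameter, the share of \<open>\<eta>\<^sub>t\<close> that goes into \<open>u\<^sub>t * m\<^sub>t\<^sub>+\<^sub>1\<close>, is taken of the form
  \<open>a + b / (t + 1 + N)\<close>. The value \<open>a = p / (p + 1)\<close> makes the chord slope agree with \<open>m\<^sub>t\<close> to
  leading order, and \<open>b\<close> moves it to the middle of the interval at the next order
  (\<open>eventually_margins\<close>, \<open>uniform_convexity_margin\<close>).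
\<close>

section \<open>Uniform convexity of powers of the norm\<close>

lemma powr_above_tangent:
  fixes x y p :: real
  assumes "p \<ge> 1" "x \<ge> 0" "y \<ge> 0"
  shows "y powr p + p * y powr (p - 1) * (x - y) \<le> x powr p"
proof -
  consider "y = 0" | "x = 0" "y > 0" | "x > 0" "y > 0"
    using assms by fastforce
  then show ?thesis
  proof cases
    case 1
    then show ?thesis by (cases "p = 1") auto
  next
    case 2
    have "y powr p = y powr (p - 1) * y"
      using powr_add[of y "p - 1" 1] 2 by simp
    then have "y powr p + p * y powr (p - 1) * (x - y) = - ((p - 1) * y powr p)"
      using 2 by (simp add: algebra_simps)
    also have "\<dots> \<le> x powr p"
      using assms by (smt (verit) mult_nonneg_nonneg powr_ge_zero)
    finally show ?thesis .
  next
    case 3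
    have "(p * y powr (p - 1)) * (x - y) \<le> x powr p - y powr p"
    proof (rule convex_on_imp_above_tangent[OF powr_convex[OF assms(1)]])
      show "((\<lambda>x. x powr p) has_real_derivative p * y powr (p - 1)) (at y within {0<..})"
        using 3 by (auto intro!: derivative_eq_intros)
    qed (use 3 in \<open>auto simp: interior_open\<close>)
    then show ?thesis by simp
  qed
qed

lemma powr_mono_convex_comb:
  fixes a b p :: real
  assumes "p \<ge> 1" "a \<ge> 0" "b \<ge> 0" "0 \<le> t" "t \<le> 1"
  shows "(t * a + (1 - t) * b) powr p \<le> t * a powr p + (1 - t) * b powr p"
proof -
  define c where "c = t * a + (1 - t) * b"
  have c0: "c \<ge> 0" using assms by (auto simp: c_def)
  have "t * (c powr p + p * c powr (p - 1) * (a - c))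
      + (1 - t) * (c powr p + p * c powr (p - 1) * (b - c))
      \<le> t * a powr p + (1 - t) * b powr p"
    using assms c0 by (intro add_mono mult_left_mono powr_above_tangent) auto
  moreover have "t * (c powr p + p * c powr (p - 1) * (a - c))
      + (1 - t) * (c powr p + p * c powr (p - 1) * (b - c))
      = c powr p + p * c powr (p - 1) * (t * a + (1 - t) * b - c)"
    by (simp add: algebra_simps)
  ultimately show ?thesis by (simp add: c_def)
qed

lemma powr_superadditive:
  fixes a b p :: real
  assumes "p \<ge> 1" "a \<ge> 0" "b \<ge> 0"
  shows "a powr p + b powr p \<le> (a + b) powr p"
proof -
  have *: "c powr p = c * c powr (p - 1)" if "c \<ge> 0" for c :: real
    using that by (simp add: powr_mult_base)
  have "a * a powr (p - 1) + b * b powr (p - 1) \<le> a * (a + b) powr (p - 1) + b * (a + b) powr (p - 1)"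
    using assms by (intro add_mono mult_left_mono powr_mono2) auto
  also have "\<dots> = (a + b) * (a + b) powr (p - 1)"
    by (simp add: algebra_simps)
  finally show ?thesis
    using assms by (simp add: *)
qed

text \<open>
  The parallelogram law raised to the power \<open>p / 2 \<ge> 1\<close>: superadditivity of that power applies
  to the sum of the two squares on one side, convexity to the mean of the squares on the other.
\<close>

lemma norm_powr_midpoint:
  fixes x y :: "'a::real_inner"
  assumes "p \<ge> 2"
  shows "norm ((1/2) *\<^sub>R (x + y)) powr p + norm ((1/2) *\<^sub>R (x - y)) powr p
    \<le> (norm x powr p + norm y powr p) / 2"
proof -
  have sq: "norm z powr p = ((norm z)\<^sup>2) powr (p / 2)" for z :: 'a
    by (simp add: powr_powr flip: powr_numeral)
  define A where "A = (norm ((1/2) *\<^sub>R (x + y)))\<^sup>2"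
  define D where "D = (norm ((1/2) *\<^sub>R (x - y)))\<^sup>2"
  have AD: "A + D = 1/2 * (norm x)\<^sup>2 + (1 - 1/2) * (norm y)\<^sup>2"
    unfolding A_def D_def power2_norm_eq_inner
    by (simp add: inner_simps inner_commute field_simps)
  have "A powr (p / 2) + D powr (p / 2) \<le> (A + D) powr (p / 2)"
    using assms by (intro powr_superadditive) (auto simp: A_def D_def)
  also have "\<dots> \<le> 1/2 * (norm x)\<^sup>2 powr (p / 2) + (1 - 1/2) * (norm y)\<^sup>2 powr (p / 2)"
    unfolding AD using assms by (intro powr_mono_convex_comb) auto
  finally show ?thesis
    unfolding sq A_def D_def by simp
qed

lemma norm_powr_convex_comb:
  fixes x y :: "'a::real_normed_vector"
  assumes "p \<ge> 1" "0 \<le> t" "t \<le> 1"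
  shows "norm (t *\<^sub>R x + (1 - t) *\<^sub>R y) powr p \<le> t * norm x powr p + (1 - t) * norm y powr p"
proof -
  have "norm (t *\<^sub>R x + (1 - t) *\<^sub>R y) \<le> t * norm x + (1 - t) * norm y"
    using assms by (intro norm_triangle_le) auto
  then have "norm (t *\<^sub>R x + (1 - t) *\<^sub>R y) powr p \<le> (t * norm x + (1 - t) * norm y) powr p"
    using assms by (intro powr_mono2) auto
  also have "\<dots> \<le> t * norm x powr p + (1 - t) * norm y powr p"
    using assms by (intro powr_mono_convex_comb) auto
  finally show ?thesis .
qed

text \<open>
  For \<open>t \<le> 1/2\<close> the point with weight \<open>t\<close> on \<open>x\<close> is the combination of the midpoint and \<open>y\<close>
  with weights \<open>2 * t\<close> and \<open>1 - 2 * t\<close>, so a share \<open>2 * t\<close> of the midpoint gap survives. The detour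
  is what yields the factor \<open>t * (1 - t)\<close>; raising the parallelogram law with weights to the power
  \<open>p / 2\<close> would only give \<open>(t * (1 - t)) powr (p / 2)\<close>.
\<close>

lemma norm_powr_uniformly_convex:
  fixes x y :: "'a::real_inner"
  assumes "p \<ge> 2" "0 \<le> t" "t \<le> 1"
  shows "norm (t *\<^sub>R x + (1 - t) *\<^sub>R y) powr p
      + 2 powr (1 - p) * (t * (1 - t)) * norm (x - y) powr p
    \<le> t * norm x powr p + (1 - t) * norm y powr p"
proof -
  have *: "norm (t *\<^sub>R x + (1 - t) *\<^sub>R y) powr p
      + 2 powr (1 - p) * (t * (1 - t)) * norm (x - y) powr p
    \<le> t * norm x powr p + (1 - t) * norm y powr p"
    if t: "0 \<le> t" "t \<le> 1/2" for t :: real and x y :: 'a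
  proof -
    define m where "m = (1/2) *\<^sub>R (x + y)"
    define D where "D = norm (x - y) powr p"
    have half: "norm ((1/2) *\<^sub>R (x - y)) powr p = 2 powr (- p) * D"
    proof -
      have "norm ((1/2) *\<^sub>R (x - y)) = norm (x - y) / 2"
        unfolding norm_scaleR by simp
      then show ?thesis
        unfolding D_def by (simp only:) (simp add: powr_divide powr_minus field_simps)
    qed
    have "norm m powr p + 2 powr (- p) * D \<le> (norm x powr p + norm y powr p) / 2"
      using norm_powr_midpoint[OF assms(1), of x y] by (simp only: half m_def)
    then have "2 * t * (norm m powr p + 2 powr (- p) * D)
        \<le> 2 * t * ((norm x powr p + norm y powr p) / 2)"
      using t by (intro mult_left_mono) auto
    moreover have "norm ((2 * t) *\<^sub>R m + (1 - 2 * t) *\<^sub>R y) powr p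
        \<le> 2 * t * norm m powr p + (1 - 2 * t) * norm y powr p"
      using assms t by (intro norm_powr_convex_comb) auto
    moreover have "(2 * t) *\<^sub>R m + (1 - 2 * t) *\<^sub>R y = t *\<^sub>R x + (1 - t) *\<^sub>R y"
    proof -
      have "1 - 2 * t = (1 - t) - t" by simp
      then show ?thesis
        by (simp only: scaleR_left_diff_distrib) (simp add: m_def scaleR_add_right)
    qed
    moreover have "2 powr (1 - p) * (t * (1 - t)) * D \<le> 2 * t * (2 powr (- p) * D)"
    proof -
      have "t * (1 - t) \<le> t" using t by (simp add: mult_left_le)
      moreover have "2 powr (1 - p) = 2 * 2 powr (- p)"
        by (simp add: powr_diff powr_minus field_simps)
      moreover have "0 \<le> 2 * 2 powr (- p) * D" by (simp add: D_def)
      ultimately have "(2 * 2 powr (- p) * D) * (t * (1 - t)) \<le> (2 * 2 powr (- p) * D) * t"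
        by (intro mult_left_mono)
      then show ?thesis
        using \<open>2 powr (1 - p) = 2 * 2 powr (- p)\<close> by (simp add: mult_ac)
    qed
    ultimately have "norm (t *\<^sub>R x + (1 - t) *\<^sub>R y) powr p
        + 2 powr (1 - p) * (t * (1 - t)) * D
      \<le> 2 * t * ((norm x powr p + norm y powr p) / 2) + (1 - 2 * t) * norm y powr p"
      by (simp only: distrib_left)
    also have "\<dots> = t * norm x powr p + (1 - t) * norm y powr p"
      by (simp add: field_simps)
    finally show ?thesis
      by (simp only: D_def)
  qed
  show ?thesis
  proof (cases "t \<le> 1/2")
    case True
    then show ?thesis using * assms by auto
  next
    case False
    then show ?thesis
      using *[of "1 - t" y x] assms by (simp add: norm_minus_commute algebra_simps)
  qed
qed

text \<open>
  The tangent at \<open>y\<close> lies below the midpoint value, which in turn lies below the chord by the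
  midpoint gap. The sign of \<open>x\<close> is arbitrary: negative \<open>x\<close> corresponds to vertices on opposite
  sides of the axis.
\<close>

lemma powr_Bregman_lower_bound:
  fixes x y p :: real
  assumes "p \<ge> 2" "y > 0"
  shows "2 powr (1 - p) * \<bar>x - y\<bar> powr p
    \<le> \<bar>x\<bar> powr p - y powr p - p * y powr (p - 1) * (x - y)"
proof -
  define m where "m = (x + y) / 2"
  define T where "T = p * y powr (p - 1)"
  define D where "D = 2 powr (1 - p) * \<bar>x - y\<bar> powr p"
  have "\<bar>(x - y) / 2\<bar> powr p = D / 2"
    by (simp add: powr_divide powr_diff D_def)
  then have "\<bar>m\<bar> powr p + D / 2 \<le> (\<bar>x\<bar> powr p + y powr p) / 2"
    using norm_powr_midpoint[OF assms(1), of x y] assms by (simp add: m_def)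
  moreover have "y powr p + T * (\<bar>m\<bar> - y) \<le> \<bar>m\<bar> powr p"
    unfolding T_def using assms by (intro powr_above_tangent) auto
  moreover have "T * (m - y) \<le> T * (\<bar>m\<bar> - y)"
    unfolding T_def using assms by (intro mult_left_mono) auto
  moreover have "T * (m - y) = T * (x - y) / 2"
    by (simp add: m_def field_simps)
  moreover have "d \<le> a - b - e" if "c + d / 2 \<le> (a + b) / 2" "b + g \<le> c" "f \<le> g" "f = e / 2"
    for a b c d e f g :: real
    using that by (simp add: field_simps)
  ultimately have "D \<le> \<bar>x\<bar> powr p - y powr p - T * (x - y)"
    by blast
  then show ?thesis by (simp only: D_def T_def)
qed

text \<open>
  The divergences from \<open>x\<close> to \<open>y\<close> and from \<open>y\<close> to \<open>x\<close> are both nonnegative, and they add up to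
  \<open>p * (x powr (p - 1) - y powr (p - 1)) * (x - y)\<close>; hence each is at most this product.
\<close>

lemma powr_Bregman_upper_bound:
  fixes x y p :: real
  assumes "p \<ge> 2" "0 \<le> x" "x \<le> r" "0 \<le> y" "y \<le> r"
  shows "x powr p - y powr p - p * y powr (p - 1) * (x - y)
    \<le> p * (p - 1) * r powr (p - 2) * (x - y)\<^sup>2"
proof -
  have slope: "a powr (p - 1) - b powr (p - 1) \<le> (p - 1) * r powr (p - 2) * (a - b)"
    if "0 \<le> b" "b \<le> a" "a \<le> r" for a b
  proof -
    have "a powr (p - 1) + (p - 1) * a powr (p - 1 - 1) * (b - a) \<le> b powr (p - 1)"
      using that assms by (intro powr_above_tangent) auto
    then have "a powr (p - 1) - b powr (p - 1) \<le> (p - 1) * (a powr (p - 2) * (a - b))"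
      by (simp add: algebra_simps)
    also have "\<dots> \<le> (p - 1) * (r powr (p - 2) * (a - b))"
      using that assms by (intro mult_left_mono mult_right_mono powr_mono2) auto
    finally show ?thesis by (simp add: mult_ac)
  qed
  have "(x powr (p - 1) - y powr (p - 1)) * (x - y) \<le> ((p - 1) * r powr (p - 2) * (x - y)) * (x - y)"
  proof (cases "y \<le> x")
    case True
    then show ?thesis using slope[of y x] assms by (intro mult_right_mono) auto
  next
    case False
    then have "(y powr (p - 1) - x powr (p - 1)) * (y - x) \<le> ((p - 1) * r powr (p - 2) * (y - x)) * (y - x)"
      using slope[of x y] assms by (intro mult_right_mono) auto
    then show ?thesis by (simp add: algebra_simps)
  qed
  then have "p * ((x powr (p - 1) - y powr (p - 1)) * (x - y))
      \<le> p * (((p - 1) * r powr (p - 2) * (x - y)) * (x - y))"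
    using assms by (intro mult_left_mono) auto
  moreover have "x powr p + p * x powr (p - 1) * (y - x) \<le> y powr p"
    using assms by (intro powr_above_tangent) auto
  ultimately show ?thesis
    by (simp add: algebra_simps power2_eq_square)
qed

section \<open>Uniformly convex caps with a prescribed vertex\<close>

text \<open>
  A compact convex body that touches the hyperplane through \<open>v\<close> with normal \<open>N\<close> at \<open>v\<close> only. Up
  to the length of \<open>N\<close>, all caps with the same \<open>p\<close> and \<open>c\<close> are congruent, which makes their
  constants of uniform convexity independent of the position.
\<close>

definition power_cap :: "real \<Rightarrow> real \<Rightarrow> 'a::real_inner \<Rightarrow> 'a \<Rightarrow> 'a set" where
  "power_cap p c N v = {z. c * norm (z - v) powr p \<le> inner N (z - v)}"

lemma closed_power_cap: "p > 0 \<Longrightarrow> closed (power_cap p c N v)"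
  unfolding power_cap_def
  by (intro closed_Collect_le continuous_intros continuous_on_powr') auto

lemma power_cap_radius:
  assumes "p > 1" "c > 0" "norm N \<le> 2" "z \<in> power_cap p c N v"
  shows "norm (z - v) \<le> (2 / c) powr (1 / (p - 1))"
proof (cases "z = v")
  case False
  define r where "r = norm (z - v)"
  have r: "r > 0" using False by (simp add: r_def)
  have "c * r powr p \<le> norm N * r"
    using assms(4) norm_cauchy_schwarz[of N "z - v"] by (simp add: power_cap_def r_def)
  also have "\<dots> \<le> 2 * r"
    using assms r by (intro mult_right_mono) auto
  finally have "c * (r powr (p - 1) * r) \<le> 2 * r"
    using r powr_add[of r "p - 1" 1] by simp
  then have "r powr (p - 1) \<le> 2 / c"
    using r assms by (simp add: field_simps)
  then have "(r powr (p - 1)) powr (1 / (p - 1)) \<le> (2 / c) powr (1 / (p - 1))"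
    using assms by (intro powr_mono2) auto
  then show ?thesis
    using assms r by (simp add: powr_powr r_def)
qed (use assms in auto)

text \<open>
  The cap is a sublevel set of \<open>\<lambda>z. c * norm (z - v) powr p - inner N (z - v)\<close>. At a convex
  combination of two points of the cap this function is negative by the uniform convexity of the
  norm power, and it is Lipschitz on bounded sets; so a displacement \<open>d\<close> up to a fixed multiple of
  the gap stays in the cap.
\<close>

lemma power_cap_absorbs:
  assumes p: "p \<ge> 2" and c: "c > 0" and N: "norm N \<le> 2"
    and x: "x \<in> power_cap p c N v" and y: "y \<in> power_cap p c N v"
    and t: "0 \<le> t" "t \<le> 1"
    and R: "R = (2 / c) powr (1 / (p - 1))"
    and d1: "norm d \<le> 1"
    and d: "(c * p * (R + 1) powr (p - 1) + 2) * norm d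
      \<le> c * 2 powr (1 - p) * (t * (1 - t)) * norm (x - y) powr p"
  shows "t *\<^sub>R x + (1 - t) *\<^sub>R y + d \<in> power_cap p c N v"
proof -
  define x' where "x' = x - v"
  define y' where "y' = y - v"
  define q where "q = t *\<^sub>R x' + (1 - t) *\<^sub>R y'"
  define D where "D = 2 powr (1 - p) * (t * (1 - t)) * norm (x - y) powr p"
  have xR: "norm x' \<le> R" and yR: "norm y' \<le> R"
    using power_cap_radius[OF _ c N] x y p unfolding R x'_def y'_def by auto
  have "norm q \<le> t * norm x' + (1 - t) * norm y'"
    unfolding q_def using t by (intro norm_triangle_le) auto
  also have "\<dots> \<le> t * R + (1 - t) * R"
    using xR yR t by (intro add_mono mult_left_mono) auto
  finally have qR: "norm q \<le> R" by (simp add: algebra_simps)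
  have "norm q powr p + D \<le> t * norm x' powr p + (1 - t) * norm y' powr p"
    using norm_powr_uniformly_convex[OF p t, of x' y'] unfolding q_def D_def x'_def y'_def by simp
  then have "c * (norm q powr p + D) \<le> t * (c * norm x' powr p) + (1 - t) * (c * norm y' powr p)"
    using c mult_left_mono[of _ _ c] by (fastforce simp: algebra_simps)
  also have "\<dots> \<le> t * inner N x' + (1 - t) * inner N y'"
    using x y t by (intro add_mono mult_left_mono) (auto simp: power_cap_def x'_def y'_def)
  also have "\<dots> = inner N q"
    by (simp add: q_def inner_simps)
  finally have q: "c * norm q powr p + c * D \<le> inner N q"
    by (simp add: algebra_simps)
  have "norm (q + d) powr p \<le> (norm q + norm d) powr p"
    using p by (intro powr_mono2 norm_triangle_ineq) auto
  also have "\<dots> \<le> norm q powr p + p * (norm q + norm d) powr (p - 1) * norm d"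
    using powr_above_tangent[of p "norm q" "norm q + norm d"] p by simp
  also have "\<dots> \<le> norm q powr p + p * (R + 1) powr (p - 1) * norm d"
    using qR d1 p by (intro add_left_mono mult_right_mono mult_left_mono powr_mono2) auto
  finally have "c * norm (q + d) powr p
      \<le> c * (norm q powr p + p * (R + 1) powr (p - 1) * norm d)"
    using c by (intro mult_left_mono) auto
  also have "\<dots> = c * norm q powr p + (c * p * (R + 1) powr (p - 1) + 2) * norm d - 2 * norm d"
    by (simp add: algebra_simps)
  also have "\<dots> \<le> inner N q - 2 * norm d"
    using q d by (simp add: D_def mult.assoc)
  also have "\<dots> \<le> inner N (q + d)"
  proof -
    have "\<bar>inner N d\<bar> \<le> norm N * norm d" by (rule Cauchy_Schwarz_ineq2)
    also have "\<dots> \<le> 2 * norm d" using N by (intro mult_right_mono) auto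
    finally show ?thesis by (simp add: inner_add_right)
  qed
  also have "q + d = t *\<^sub>R x + (1 - t) *\<^sub>R y + d - v"
    by (simp add: q_def x'_def y'_def algebra_simps)
  finally show ?thesis
    by (simp add: power_cap_def)
qed

text \<open>
  The modulus obtained from \<open>power_cap_absorbs\<close> is common to all caps, and uniform convexity with
  a fixed modulus passes to intersections.
\<close>

lemma power_uniformly_convex_INT_power_cap:
  fixes N v :: "'i \<Rightarrow> 'a::real_inner"
  assumes p: "p \<ge> 2" and c: "c > 0" and N: "\<And>i. norm (N i) \<le> 2"
  shows "power_uniformly_convex_set p (\<Inter>i. power_cap p c (N i) (v i))" (is "power_uniformly_convex_set p ?C")
proof -
  define R where "R = (2 / c) powr (1 / (p - 1))"
  define K where "K = c * p * (R + 1) powr (p - 1) + 2"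
  \<comment> \<open>The second bound keeps the displacement below 1, since points of a cap are at most 2 * R apart.\<close>
  define \<alpha> where "\<alpha> = min (c * 2 powr (1 - p) / K) (1 / (2 * R) powr p)"
  have R: "R > 0" using c by (simp add: R_def)
  have K: "K > 0" using c p by (auto simp: K_def intro!: add_nonneg_pos)
  have \<alpha>: "\<alpha> > 0" using c K R by (simp add: \<alpha>_def)
  have "uniformly_convex_set (\<lambda>r. \<alpha> * r powr p) ?C"
    unfolding uniformly_convex_set_def
  proof (intro conjI ballI allI impI)
    show "closed ?C" using p by (intro closed_INT ballI closed_power_cap) auto
    show "0 \<le> \<alpha> * r powr p" for r using \<alpha> by simp
    show "mono_on {0..} (\<lambda>r. \<alpha> * r powr p)"
      using \<alpha> p by (intro mono_onI mult_left_mono powr_mono2) auto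
  next
    fix x y :: 'a and t :: real and z :: 'a
    assume xy: "x \<in> ?C" "y \<in> ?C" and t: "t \<in> {0..1}" and z: "norm z = 1"
    define d where "d = (t * (1 - t) * (\<alpha> * norm (x - y) powr p)) *\<^sub>R z"
    have tt: "0 \<le> t * (1 - t)" "t * (1 - t) \<le> 1"
      using t by (auto simp: mult_le_one)
    have nd: "norm d = t * (1 - t) * (\<alpha> * norm (x - y) powr p)"
      unfolding d_def norm_scaleR z using tt \<alpha> by simp
    show "t *\<^sub>R x + (1 - t) *\<^sub>R y + (t * (1 - t) * (\<alpha> * norm (x - y) powr p)) *\<^sub>R z \<in> ?C"
      unfolding d_def[symmetric]
    proof
      fix i
      have xi: "x \<in> power_cap p c (N i) (v i)" and yi: "y \<in> power_cap p c (N i) (v i)"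
        using xy by auto
      have "norm (x - y) \<le> norm (x - v i) + norm (y - v i)"
        using norm_triangle_ineq4[of "x - v i" "y - v i"] by simp
      also have "\<dots> \<le> 2 * R"
        using power_cap_radius[OF _ c N xi] power_cap_radius[OF _ c N yi] p by (simp add: R_def)
      finally have "norm (x - y) powr p \<le> (2 * R) powr p"
        using p by (intro powr_mono2) auto
      then have "\<alpha> * norm (x - y) powr p \<le> 1 / (2 * R) powr p * (2 * R) powr p"
        using R by (intro mult_mono) (auto simp: \<alpha>_def)
      then have le1: "\<alpha> * norm (x - y) powr p \<le> 1" using R by simp
      have nd1: "norm d \<le> 1"
        unfolding nd by (rule mult_le_one[OF tt(2) _ le1]) (use \<alpha> in simp)
      have "K * norm d = (K * \<alpha>) * (t * (1 - t) * norm (x - y) powr p)"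
        unfolding nd by (simp add: mult_ac)
      also have "\<dots> \<le> (K * (c * 2 powr (1 - p) / K)) * (t * (1 - t) * norm (x - y) powr p)"
        using K tt by (intro mult_right_mono mult_left_mono) (auto simp: \<alpha>_def)
      also have "\<dots> = c * 2 powr (1 - p) * (t * (1 - t)) * norm (x - y) powr p"
        using K by (simp add: mult_ac)
      finally have "K * norm d \<le> c * 2 powr (1 - p) * (t * (1 - t)) * norm (x - y) powr p" .
      then show "t *\<^sub>R x + (1 - t) *\<^sub>R y + d \<in> power_cap p c (N i) (v i)"
        using t nd1 by (intro power_cap_absorbs[OF p c N xi yi _ _ R_def]) (auto simp: K_def)
    qed
  qed
  then show ?thesis
    unfolding power_uniformly_convex_set_def using p \<alpha> by blast
qed

lemma convex_power_cap:
  assumes p: "p \<ge> 2" and c: "c > 0" and N: "norm N \<le> 2"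
  shows "convex (power_cap p c N v)"
proof (rule convexI)
  fix x y :: 'a and a b :: real
  assume "x \<in> power_cap p c N v" "y \<in> power_cap p c N v" "0 \<le> a" "0 \<le> b" "a + b = 1"
  moreover from this have "b = 1 - a" by simp
  ultimately show "a *\<^sub>R x + b *\<^sub>R y \<in> power_cap p c N v"
    using power_cap_absorbs[OF p c N, of x v y a _ 0] c by simp
qed

lemma compact_power_cap:
  fixes v :: "'a::euclidean_space"
  assumes "p > 1" "c > 0" "norm N \<le> 2"
  shows "compact (power_cap p c N v)"
proof -
  have "power_cap p c N v \<subseteq> cball v ((2 / c) powr (1 / (p - 1)))"
    using power_cap_radius[OF assms] by (auto simp: dist_norm norm_minus_commute)
  then have "bounded (power_cap p c N v)"
    using bounded_cball bounded_subset by blast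
  then show ?thesis
    using assms closed_power_cap[of p] by (simp add: compact_eq_bounded_closed)
qed

lemma power_cap_unique_minimizer:
  assumes "c > 0" "v \<in> C" "C \<subseteq> power_cap p c N v"
  shows "is_arg_min (inner N) (\<lambda>w. w \<in> C) w \<longleftrightarrow> w = v"
proof -
  have pos: "inner N v < inner N z" if "z \<in> C" "z \<noteq> v" for z
  proof -
    have "0 < c * norm (z - v) powr p" using that assms by simp
    also have "\<dots> \<le> inner N (z - v)" using that assms by (auto simp: power_cap_def)
    finally show ?thesis by (simp add: inner_diff_right)
  qed
  show ?thesis
  proof
    assume "is_arg_min (inner N) (\<lambda>w. w \<in> C) w"
    then show "w = v" unfolding is_arg_min_def using pos assms by blast
  next
    assume "w = v"
    then show "is_arg_min (inner N) (\<lambda>w. w \<in> C) w"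
      unfolding is_arg_min_def using pos assms by (metis less_asym)
  qed
qed

section \<open>Frank--Wolfe on a squared norm\<close>

lemma GDERIV_norm_sq:
  fixes x :: "'a::real_inner"
  shows "GDERIV (\<lambda>z. K * (norm z)\<^sup>2) x :> (2 * K) *\<^sub>R x"
  unfolding gderiv_def power2_norm_eq_inner
  by (rule has_derivative_eq_rhs, (rule derivative_intros)+)
     (auto simp: inner_commute algebra_simps)

lemma gradient_norm_sq: "gradient (\<lambda>z. K * (norm z)\<^sup>2) x = (2 * K) *\<^sub>R x"
  for x :: "'a::real_inner"
  by (rule gradient_eqI[OF GDERIV_norm_sq])

lemma norm_sq_second_order_expansion:
  fixes x y :: "'a::real_inner"
  shows "K * (norm x)\<^sup>2 = K * (norm y)\<^sup>2 + inner ((2 * K) *\<^sub>R y) (x - y) + 2 * K / 2 * (norm (x - y))\<^sup>2"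
  unfolding power2_norm_eq_inner by (simp add: inner_simps inner_commute algebra_simps)

lemma smooth_strongly_convex_norm_sq:
  assumes "K > 0"
  shows "smooth_fun_on C (\<lambda>z. K * (norm z)\<^sup>2)" "strongly_convex_fun_on C (\<lambda>z. K * (norm z)\<^sup>2)"
proof -
  have "differentiable_near C (\<lambda>z. K * (norm z)\<^sup>2)"
    unfolding differentiable_near_def
    using GDERIV_norm_sq by (intro exI[of _ UNIV]) (auto simp: gderiv_def differentiable_def)
  then show "smooth_fun_on C (\<lambda>z. K * (norm z)\<^sup>2)" "strongly_convex_fun_on C (\<lambda>z. K * (norm z)\<^sup>2)"
    unfolding smooth_fun_on_def strongly_convex_fun_on_def gradient_norm_sq
    using assms
    by (intro conjI exI[of _ "2 * K"] ballI order_eq_refl norm_sq_second_order_expansion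
        norm_sq_second_order_expansion[symmetric]; simp)+
qed

text \<open>
  By Pythagoras the objective at parameter \<open>s\<close> exceeds its value at the foot of the
  perpendicular by \<open>K * ((s - g) * norm d)\<^sup>2\<close>.
\<close>

lemma is_arg_min_norm_sq_segment:
  fixes x d :: "'a::real_inner"
  assumes "K > 0" "d \<noteq> 0" "g \<in> {0..1}" "inner (x + g *\<^sub>R d) d = 0"
  shows "is_arg_min (\<lambda>s. K * (norm (x + s *\<^sub>R d))\<^sup>2) (\<lambda>s. s \<in> {0..1}) s \<longleftrightarrow> s = g"
proof -
  have eq: "K * (norm (x + s *\<^sub>R d))\<^sup>2 = K * (norm (x + g *\<^sub>R d))\<^sup>2 + K * ((s - g) * norm d)\<^sup>2" for s
  proof -
    have "x + s *\<^sub>R d = (x + g *\<^sub>R d) + (s - g) *\<^sub>R d" by (simp add: algebra_simps)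
    also have "(norm \<dots>)\<^sup>2 = (norm (x + g *\<^sub>R d))\<^sup>2 + (norm ((s - g) *\<^sub>R d))\<^sup>2"
      using assms(4) by (intro norm_add_Pythagorean) (simp add: orthogonal_def)
    finally show ?thesis by (simp add: power_mult_distrib distrib_left)
  qed
  have less: "K * (norm (x + g *\<^sub>R d))\<^sup>2 < K * (norm (x + s *\<^sub>R d))\<^sup>2" if "s \<noteq> g" for s
    unfolding eq[of s] using that assms by simp
  show ?thesis
    unfolding is_arg_min_def using less assms(3) by (metis less_asym less_irrefl)
qed

locale orthonormal_pair =
  fixes e1 e2 :: "'a::euclidean_space"
  assumes norm_e1: "norm e1 = 1" and norm_e2: "norm e2 = 1" and orth: "inner e1 e2 = 0"
begin

definition pt :: "real \<Rightarrow> real \<Rightarrow> 'a" where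
  "pt a b = a *\<^sub>R e1 + b *\<^sub>R e2"

lemma inner_pt [simp]: "inner (pt a b) (pt c d) = a * c + b * d"
  using norm_e1 norm_e2 orth
  by (simp add: pt_def inner_simps inner_commute norm_eq_1)

lemma norm_pt: "(norm (pt a b))\<^sup>2 = a\<^sup>2 + b\<^sup>2"
  unfolding power2_norm_eq_inner by (simp add: power2_eq_square)

lemma norm_pt_le: "norm (pt a b) \<le> \<bar>a\<bar> + \<bar>b\<bar>"
  unfolding pt_def by (rule norm_triangle_le) (simp add: norm_e1 norm_e2)

lemma pt_diff: "pt a b - pt c d = pt (a - c) (b - d)"
  by (simp add: pt_def algebra_simps)

lemma pt_add: "pt a b + pt c d = pt (a + c) (b + d)"
  by (simp add: pt_def algebra_simps)

lemma scaleR_pt: "s *\<^sub>R pt a b = pt (s * a) (s * b)"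
  by (simp add: pt_def algebra_simps)

lemma pt_eq_iff: "pt a b = pt c d \<longleftrightarrow> a = c \<and> b = d"
proof
  assume "pt a b = pt c d"
  then have "(norm (pt (a - c) (b - d)))\<^sup>2 = 0" by (simp flip: pt_diff)
  then show "a = c \<and> b = d" unfolding norm_pt by (simp add: sum_power2_eq_zero_iff)
qed simp

text \<open>
  The assumptions \<open>foot\<close> and \<open>line\<close> say that \<open>\<xi> t *\<^sub>R N t\<close> and \<open>v t\<close> both lie on the line
  perpendicular to \<open>N (Suc t)\<close> through \<open>\<xi> (Suc t) *\<^sub>R N (Suc t)\<close>, which is therefore the point of
  that line closest to the origin, and \<open>inside\<close> puts it on the segment. Since the gradient at an
  iterate is a positive multiple of \<open>N t\<close>, all choices of the algorithm are forced.
\<close>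

lemma frank_wolfe_zigzag:
  fixes m \<xi> u w :: "nat \<Rightarrow> real" and C :: "'a set"
  defines "N \<equiv> \<lambda>t. pt ((-1) ^ t * m t) 1"
  defines "v \<equiv> \<lambda>t. pt (- ((-1) ^ t * u t)) (w t)"
  assumes K: "K > 0" and m: "\<And>t. m t > 0" and \<xi>: "\<And>t. \<xi> t > 0" and u: "\<And>t. u t > 0"
    and foot: "\<And>t. \<xi> (Suc t) * (1 + (m (Suc t))\<^sup>2) = \<xi> t * (1 - m t * m (Suc t))"
    and line: "\<And>t. u t * m (Suc t) + w t = \<xi> t * (1 - m t * m (Suc t))"
    and inside: "\<And>t. \<xi> (Suc t) * m (Suc t) \<le> u t"
    and vertex: "\<And>t z. is_arg_min (inner (N t)) (\<lambda>z. z \<in> C) z \<longleftrightarrow> z = v t"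
  shows "frank_wolfe_line_search C (\<lambda>z. K * (norm z)\<^sup>2) (\<xi> 0 *\<^sub>R N 0) x
    \<longleftrightarrow> x = (\<lambda>t. \<xi> t *\<^sub>R N t)"
proof -
  define X where "X = (\<lambda>t. \<xi> t *\<^sub>R N t)"
  define \<gamma> where "\<gamma> t = (\<xi> t * m t + \<xi> (Suc t) * m (Suc t)) / (u t + \<xi> t * m t)" for t
  have pos: "0 < \<xi> t * m t" for t using m \<xi> by simp
  have \<gamma>: "\<gamma> t \<in> {0..1}" for t
    using pos[of t] pos[of "Suc t"] u[of t] inside[of t] by (simp add: \<gamma>_def field_simps)
  have step: "X (Suc t) = X t + \<gamma> t *\<^sub>R (v t - X t)" for t
  proof -
    define s where "s = \<xi> t * m t + \<xi> (Suc t) * m (Suc t)"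
    define D where "D = u t + \<xi> t * m t"
    have D: "D > 0" using pos[of t] u[of t] by (simp add: D_def)
    have \<gamma>D: "\<gamma> t * D = s" using D by (simp add: \<gamma>_def D_def s_def)
    have diff: "\<xi> t - \<xi> (Suc t) = m (Suc t) * s"
      using foot[of t] by (simp add: s_def algebra_simps power2_eq_square)
    \<comment> \<open>The two coordinates of the step must lead to the same parameter: \<open>D\<close> and \<open>s\<close> are the lengths
      of the whole segment and of the step in the first coordinate.\<close>
    have "(\<xi> t - \<xi> (Suc t)) * D = (\<xi> t - w t) * s"
    proof -
      have "(u t * m (Suc t) + w t) * (\<xi> t * m t) + (u t * m (Suc t) + w t) * (\<xi> (Suc t) * m (Suc t))
        = (\<xi> (Suc t) * (1 + (m (Suc t))\<^sup>2)) * (\<xi> t * m t)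
        + (\<xi> t * (1 - m t * m (Suc t))) * (\<xi> (Suc t) * m (Suc t))"
        by (simp only: line foot)
      then have *: "(u t * m (Suc t) + w t) * s = \<xi> t * \<xi> (Suc t) * (m t + m (Suc t))"
        by (simp add: s_def algebra_simps power2_eq_square)
      have "(\<xi> t - \<xi> (Suc t)) * D = m (Suc t) * s * u t + \<xi> t * m t * (\<xi> t - \<xi> (Suc t))"
        by (simp add: D_def diff algebra_simps)
      also have "\<dots> = (u t * m (Suc t) + w t) * s - w t * s + \<xi> t * m t * (\<xi> t - \<xi> (Suc t))"
        by (simp add: algebra_simps)
      also have "\<dots> = (\<xi> t - w t) * s"
        unfolding * by (simp add: s_def algebra_simps)
      finally show ?thesis .
    qed
    then have "(\<xi> t - \<xi> (Suc t)) * D = (\<gamma> t * (\<xi> t - w t)) * D"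
      by (simp add: mult_ac flip: \<gamma>D)
    then have "\<xi> t - \<xi> (Suc t) = \<gamma> t * (\<xi> t - w t)" using D by simp
    then have "\<xi> (Suc t) = \<xi> t + \<gamma> t * (w t - \<xi> t)" by (simp add: algebra_simps)
    moreover have "\<xi> (Suc t) * ((-1) ^ Suc t * m (Suc t))
        = \<xi> t * ((-1) ^ t * m t) + \<gamma> t * (- ((-1) ^ t * u t) - \<xi> t * ((-1) ^ t * m t))"
    proof -
      have "\<xi> (Suc t) * ((-1) ^ Suc t * m (Suc t)) = (-1) ^ t * (\<xi> t * m t - s)"
        by (simp add: s_def)
      also have "\<dots> = (-1) ^ t * (\<xi> t * m t - \<gamma> t * D)"
        by (simp only: \<gamma>D)
      also have "\<dots> = \<xi> t * ((-1) ^ t * m t) + \<gamma> t * (- ((-1) ^ t * u t) - \<xi> t * ((-1) ^ t * m t))"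
        by (simp add: D_def algebra_simps)
      finally show ?thesis .
    qed
    ultimately show ?thesis
      by (simp add: X_def N_def v_def scaleR_pt pt_diff pt_add pt_eq_iff)
  qed
  have "inner (N (Suc t)) (v t - X t) = 0" for t
  proof -
    have "inner (N (Suc t)) (v t - X t) = ((-1) ^ t * (-1) ^ t) * (u t * m (Suc t) + \<xi> t * (m t * m (Suc t))) + w t - \<xi> t"
      by (simp add: X_def N_def v_def scaleR_pt pt_diff algebra_simps)
    then show ?thesis using line[of t] by (simp add: algebra_simps flip: power_mult_distrib)
  qed
  then have orthogonal: "inner (X t + \<gamma> t *\<^sub>R (v t - X t)) (v t - X t) = 0" for t
    unfolding step[symmetric] by (simp add: X_def)
  have ne: "v t - X t \<noteq> 0" for t
  proof
    assume "v t - X t = 0"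
    then have "- ((-1) ^ t * u t) = \<xi> t * ((-1) ^ t * m t)"
      by (simp add: X_def N_def v_def scaleR_pt pt_eq_iff)
    then have "(-1) ^ t * (u t + \<xi> t * m t) = 0" by (simp add: algebra_simps)
    then show False using pos[of t] u[of t] by simp
  qed
  have line_search: "is_arg_min (\<lambda>s. K * (norm (X t + s *\<^sub>R (v t - X t)))\<^sup>2) (\<lambda>s. s \<in> {0..1}) s
      \<longleftrightarrow> s = \<gamma> t" for t s
    by (rule is_arg_min_norm_sq_segment[OF K ne \<gamma> orthogonal])
  have minimizer: "is_arg_min (inner (gradient (\<lambda>z. K * (norm z)\<^sup>2) (X t))) (\<lambda>z. z \<in> C) z \<longleftrightarrow> z = v t" for t z
    unfolding vertex[symmetric] gradient_norm_sq
    using K \<xi>[of t] by (simp add: X_def is_arg_min_def)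
  have "x t = X t" if x: "frank_wolfe_line_search C (\<lambda>z. K * (norm z)\<^sup>2) (\<xi> 0 *\<^sub>R N 0) x" for t
  proof -
    from x[unfolded frank_wolfe_line_search_def] obtain v' \<gamma>' where x0: "x 0 = \<xi> 0 *\<^sub>R N 0"
      and run: "\<forall>t. is_arg_min (inner (gradient (\<lambda>z. K * (norm z)\<^sup>2) (x t))) (\<lambda>w. w \<in> C) (v' t) \<and>
        is_arg_min (\<lambda>s. K * (norm (x t + s *\<^sub>R (v' t - x t)))\<^sup>2) (\<lambda>s. s \<in> {0..1}) (\<gamma>' t) \<and>
        x (Suc t) = x t + \<gamma>' t *\<^sub>R (v' t - x t)"
      by (elim conjE exE) (rule that)
    show ?thesis
    proof (induction t)
      case (Suc t)
      have "v' t = v t" using run[rule_format, of t] Suc minimizer by simp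
      moreover have "\<gamma>' t = \<gamma> t" using run[rule_format, of t] Suc \<open>v' t = v t\<close> line_search by simp
      ultimately show ?case using run[rule_format, of t] Suc step by simp
    qed (simp add: x0 X_def)
  qed
  moreover have "frank_wolfe_line_search C (\<lambda>z. K * (norm z)\<^sup>2) (\<xi> 0 *\<^sub>R N 0) X"
    unfolding frank_wolfe_line_search_def
    using minimizer line_search step by (intro conjI exI[of _ v] exI[of _ \<gamma>]) (auto simp: X_def[THEN fun_cong])
  ultimately show ?thesis
    unfolding X_def[symmetric] by blast
qed

end

section \<open>A uniformly convex set with prescribed vertices\<close>

text \<open>
  The chord slopes of the points \<open>(U t, W t)\<close> separate consecutive values of \<open>M\<close>. Therefore the
  piecewise linear interpolation is convex with subgradient \<open>M t\<close> at \<open>U t\<close>.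
\<close>

lemma interlaced_slopes_imp_above_tangent:
  fixes U W M :: "nat \<Rightarrow> real"
  assumes dec: "\<And>t. U (Suc t) < U t"
    and lower: "\<And>t. M (Suc t) * (U t - U (Suc t)) \<le> W t - W (Suc t)"
    and upper: "\<And>t. W t - W (Suc t) \<le> M t * (U t - U (Suc t))"
  shows "W t + M t * (U s - U t) \<le> W s"
proof -
  have M: "M (Suc t) \<le> M t" for t
    using order_trans[OF lower[of t] upper[of t]] dec[of t] by simp
  have M_le: "s \<le> t \<Longrightarrow> M t \<le> M s" and U_le: "s \<le> t \<Longrightarrow> U t \<le> U s" for s t
    using M dec by (auto intro: lift_Suc_antimono_le less_imp_le)
  show ?thesis
  proof (cases "t \<le> s")
    case True
    then show ?thesis
    proof (induction s rule: dec_induct)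
      case (step s)
      have "M s * (U s - U (Suc s)) \<le> M t * (U s - U (Suc s))"
        using M_le[OF step(1)] dec[of s] by (intro mult_right_mono) auto
      then show ?case using step.IH upper[of s] by (simp add: algebra_simps)
    qed simp
  next
    case False
    then have "s \<le> t" by simp
    then show ?thesis
    proof (induction t rule: dec_induct)
      case (step t)
      have "M (Suc t) * (U s - U t) \<le> M t * (U s - U t)"
        using M U_le[OF step(1)] by (intro mult_right_mono) auto
      then show ?case using step.IH lower[of t] by (simp add: algebra_simps)
    qed simp
  qed
qed

context orthonormal_pair
begin

text \<open>
  Reflected to the side of the vertex, the point has the first coordinate \<open>a\<close> or \<open>- a\<close>. For \<open>a\<close> the
  bound by the divergence is the assumption \<open>above\<close>; passing to \<open>- a\<close> changes the two sides by
  \<open>2 * a * m\<close> and \<open>2 * a\<close> times the derivative of \<open>\<lambda>u. c * u powr p\<close>, which \<open>slope\<close> compares.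
  The divergence is then bounded below by a power of the horizontal distance, and by \<open>lip\<close> the
  horizontal distance controls the full one.
\<close>

lemma pt_in_power_cap:
  assumes p: "p \<ge> 2" and c: "c > 0" and u: "u > 0" and \<sigma>: "\<sigma> = 1 \<or> \<sigma> = -1"
    and x: "x = a \<or> x = - a" and a: "a \<ge> 0"
    and above: "c * (a powr p - u powr p - p * u powr (p - 1) * (a - u)) \<le> b - w - m * (a - u)"
    and lip: "\<bar>b - w\<bar> \<le> \<bar>a - u\<bar>"
    and slope: "c * (p * u powr (p - 1)) \<le> m"
  shows "pt x b \<in> power_cap p (c * 2 powr (1 - p) * 2 powr (- p)) (pt (\<sigma> * m) 1) (pt (- (\<sigma> * u)) w)"
proof -
  define y where "y = - (\<sigma> * x)"
  have y: "y = a \<or> y = - a" using x \<sigma> by (auto simp: y_def)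
  have yu: "\<bar>x + \<sigma> * u\<bar> = \<bar>y - u\<bar>" using \<sigma> by (auto simp: y_def)
  have inn: "inner (pt (\<sigma> * m) 1) (pt x b - pt (- (\<sigma> * u)) w) = b - w - m * (y - u)"
    using \<sigma> by (auto simp: pt_diff y_def algebra_simps)
  have "norm (pt x b - pt (- (\<sigma> * u)) w) \<le> \<bar>y - u\<bar> + \<bar>b - w\<bar>"
    unfolding pt_diff using norm_pt_le[of "x - (- (\<sigma> * u))" "b - w"] yu by simp
  also have "\<dots> \<le> 2 * \<bar>y - u\<bar>"
    using lip y a u by (auto simp: abs_if split: if_splits)
  finally have "norm (pt x b - pt (- (\<sigma> * u)) w) powr p \<le> (2 * \<bar>y - u\<bar>) powr p"
    using p by (intro powr_mono2) auto
  then have "2 powr (- p) * norm (pt x b - pt (- (\<sigma> * u)) w) powr p \<le> \<bar>y - u\<bar> powr p"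
    by (simp add: powr_mult powr_minus field_simps)
  then have "(c * 2 powr (1 - p)) * (2 powr (- p) * norm (pt x b - pt (- (\<sigma> * u)) w) powr p)
      \<le> (c * 2 powr (1 - p)) * \<bar>y - u\<bar> powr p"
    using c by (intro mult_left_mono) auto
  also have "\<dots> \<le> c * (\<bar>y\<bar> powr p - u powr p - p * u powr (p - 1) * (y - u))"
    using powr_Bregman_lower_bound[OF p u, of y] c by (simp add: mult.assoc)
  also have "\<dots> = c * (a powr p - u powr p - p * u powr (p - 1) * (a - u))
      + c * (p * u powr (p - 1)) * (a - y)"
    using y a by (auto simp: algebra_simps)
  also have "\<dots> \<le> (b - w - m * (a - u)) + m * (a - y)"
    using above slope y a by (intro add_mono mult_right_mono) auto
  also have "\<dots> = b - w - m * (y - u)" by (simp add: algebra_simps)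
  finally show ?thesis
    unfolding power_cap_def mem_Collect_eq inn by (simp add: mult.assoc)
qed

text \<open>
  Subtracting \<open>c * u t powr p\<close> from \<open>w t\<close>, and its derivative from \<open>m t\<close>, turns \<open>upper\<close> and
  \<open>lower\<close> into the interlacing condition, so the modified points lie above all their modified
  tangents. Adding the subtracted terms back bounds the gap of every pair of vertices below by a
  divergence of \<open>\<lambda>u. c * u powr p\<close>, which puts every vertex into every cap. The origin is in
  all caps as the limit of the vertices.
\<close>

lemma exists_zigzag_set:
  fixes m \<xi> u w :: "nat \<Rightarrow> real"
  defines "N \<equiv> \<lambda>t. pt ((-1) ^ t * m t) 1"
  assumes p: "p \<ge> 2" and K: "K > 0"
    and m: "\<And>t. m t > 0" and m_le: "\<And>t. m t \<le> 1/2" and \<xi>: "\<And>t. \<xi> t > 0"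
    and u: "\<And>t. u t > 0" and u_dec: "\<And>t. u (Suc t) < u t"
    and u_lim: "u \<longlonglongrightarrow> 0" and w_lim: "w \<longlonglongrightarrow> 0"
    and foot: "\<And>t. \<xi> (Suc t) * (1 + (m (Suc t))\<^sup>2) = \<xi> t * (1 - m t * m (Suc t))"
    and line: "\<And>t. u t * m (Suc t) + w t = \<xi> t * (1 - m t * m (Suc t))"
    and inside: "\<And>t. \<xi> (Suc t) * m (Suc t) \<le> u t"
    and c: "c > 0" and slope: "\<And>t. c * (p * u t powr (p - 1)) \<le> m t"
    and upper: "\<And>t. c * (u (Suc t) powr p - u t powr p - p * u t powr (p - 1) * (u (Suc t) - u t))
      \<le> w (Suc t) - w t - m t * (u (Suc t) - u t)"
    and lower: "\<And>t. c * (u t powr p - u (Suc t) powr p - p * u (Suc t) powr (p - 1) * (u t - u (Suc t)))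
      \<le> w t - w (Suc t) - m (Suc t) * (u t - u (Suc t))"
  shows "\<exists>C. compact C \<and> convex C \<and> power_uniformly_convex_set p C \<and> 0 \<in> C \<and> \<xi> 0 *\<^sub>R N 0 \<in> C \<and>
    (\<forall>x. frank_wolfe_line_search C (\<lambda>z. K * (norm z)\<^sup>2) (\<xi> 0 *\<^sub>R N 0) x \<longleftrightarrow> x = (\<lambda>t. \<xi> t *\<^sub>R N t))"
proof -
  define v where "v t = pt (- ((-1) ^ t * u t)) (w t)" for t
  define \<sigma> :: "nat \<Rightarrow> real" where "\<sigma> t = (-1) ^ t" for t
  have \<sigma>: "\<sigma> t = 1 \<or> \<sigma> t = -1" for t
    unfolding \<sigma>_def by (induction t) auto
  define W where "W t = w t - c * u t powr p" for t
  define M where "M t = m t - c * (p * u t powr (p - 1))" for t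
  have tangent: "W t + M t * (u s - u t) \<le> W s" for s t
    using u_dec
  proof (rule interlaced_slopes_imp_above_tangent)
    show "M (Suc t) * (u t - u (Suc t)) \<le> W t - W (Suc t)" for t
      using lower[of t] by (simp add: W_def M_def algebra_simps)
    show "W t - W (Suc t) \<le> M t * (u t - u (Suc t))" for t
      using upper[of t] by (simp add: W_def M_def algebra_simps)
  qed
  have above: "c * (u s powr p - u t powr p - p * u t powr (p - 1) * (u s - u t))
      \<le> w s - w t - m t * (u s - u t)" for s t
    using tangent[of t s] by (simp add: W_def M_def algebra_simps)
  have w_dec: "w (Suc t) \<le> w t" and uw_dec: "u (Suc t) - w (Suc t) \<le> u t - w t" for t
  proof -
    have "0 \<le> c * (u t powr p - u (Suc t) powr p - p * u (Suc t) powr (p - 1) * (u t - u (Suc t)))"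
      using powr_above_tangent[of p "u t" "u (Suc t)"] p c u[of t] u[of "Suc t"]
      by (intro mult_nonneg_nonneg) auto
    then have "0 \<le> w t - w (Suc t) - m (Suc t) * (u t - u (Suc t))"
      using lower[of t] by linarith
    moreover have "0 \<le> m (Suc t) * (u t - u (Suc t))"
      using m[of "Suc t"] u_dec[of t] by simp
    ultimately show "w (Suc t) \<le> w t" by linarith
    have "0 \<le> c * (u (Suc t) powr p - u t powr p - p * u t powr (p - 1) * (u (Suc t) - u t))"
      using powr_above_tangent[of p "u (Suc t)" "u t"] p c u[of t] u[of "Suc t"]
      by (intro mult_nonneg_nonneg) auto
    then have "w t - w (Suc t) \<le> m t * (u t - u (Suc t))"
      using upper[of t] by (simp add: algebra_simps)
    also have "\<dots> \<le> 1 * (u t - u (Suc t))"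
      using m_le[of t] u_dec[of t] by (intro mult_right_mono) auto
    finally show "u (Suc t) - w (Suc t) \<le> u t - w t" by simp
  qed
  have lip: "\<bar>w s - w t\<bar> \<le> \<bar>u s - u t\<bar>" for s t
  proof -
    have *: "\<bar>w s - w t\<bar> \<le> \<bar>u s - u t\<bar>" if "s \<le> t" for s t
      using lift_Suc_antimono_le[of w, OF w_dec that]
        lift_Suc_antimono_le[of "\<lambda>t. u t - w t", OF uw_dec that] by linarith
    show ?thesis
      using *[of s t] *[of t s] by (cases "s \<le> t") (auto simp: abs_minus_commute)
  qed
  have above0: "c * (0 powr p - u t powr p - p * u t powr (p - 1) * (0 - u t))
      \<le> 0 - w t - m t * (0 - u t)" for t
  proof -
    have W_lim: "W \<longlonglongrightarrow> 0 - c * 0 powr p"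
      unfolding W_def using p u less_imp_le[OF u]
      by (intro tendsto_intros tendsto_powr' u_lim w_lim) (auto intro: always_eventually)
    have "(\<lambda>s. W t + M t * (u s - u t)) \<longlonglongrightarrow> W t + M t * (0 - u t)"
      by (intro tendsto_intros u_lim)
    then have "W t + M t * (0 - u t) \<le> 0 - c * 0 powr p"
      by (rule LIMSEQ_le[OF _ W_lim]) (use tangent in blast)
    then show ?thesis using p by (simp add: W_def M_def algebra_simps)
  qed
  have lip0: "\<bar>0 - w t\<bar> \<le> \<bar>0 - u t\<bar>" for t
  proof (rule LIMSEQ_le)
    show "(\<lambda>s. \<bar>w s - w t\<bar>) \<longlonglongrightarrow> \<bar>0 - w t\<bar>" by (intro tendsto_intros w_lim)
    show "(\<lambda>s. \<bar>u s - u t\<bar>) \<longlonglongrightarrow> \<bar>0 - u t\<bar>" by (intro tendsto_intros u_lim)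
  qed (use lip in blast)
  define r where "r = 2 * \<xi> 0 + 2 * u 0"
  define c1 where "c1 = c * 2 powr (1 - p) * 2 powr (- p)"
  \<comment> \<open>Shrinking the cap constant enlarges the caps until they contain the starting point as well.\<close>
  define c2 where "c2 = min c1 (\<xi> 0 / (2 * r powr p))"
  have r: "r > 0" using \<xi>[of 0] u[of 0] by (simp add: r_def)
  have c2: "c2 > 0" using c r \<xi>[of 0] by (simp add: c2_def c1_def)
  have caps: "power_cap p c1 n z \<subseteq> power_cap p c2 n z" for n z
  proof
    fix y assume "y \<in> power_cap p c1 n z"
    moreover have "c2 * norm (y - z) powr p \<le> c1 * norm (y - z) powr p"
      by (intro mult_right_mono) (auto simp: c2_def)
    ultimately show "y \<in> power_cap p c2 n z" by (simp add: power_cap_def)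
  qed
  define C where "C = (\<Inter>t. power_cap p c2 (N t) (v t))"
  have "v s \<in> power_cap p c1 (N t) (v t)" for s t
    unfolding v_def N_def c1_def \<sigma>_def[symmetric]
    using above[of s t] lip[of s t] slope[of t] u[of t] less_imp_le[OF u[of s]] \<sigma>[of s] \<sigma>[of t]
    by (intro pt_in_power_cap[where a = "u s", OF p c]) auto
  then have vC: "v s \<in> C" for s unfolding C_def using caps by blast
  have "pt 0 0 \<in> power_cap p c1 (N t) (v t)" for t
    unfolding v_def N_def c1_def \<sigma>_def[symmetric]
    using above0[of t] lip0[of t] slope[of t] u[of t] \<sigma>[of t]
    by (intro pt_in_power_cap[where a = 0, OF p c]) auto
  then have zero: "0 \<in> power_cap p c1 (N t) (v t)" for t by (simp add: pt_def)
  then have zeroC: "0 \<in> C" unfolding C_def using caps by blast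
  have x0: "\<xi> 0 *\<^sub>R N 0 \<in> C"
    unfolding C_def
  proof
    fix t
    have "u t \<le> u 0" using lift_Suc_antimono_le[of u 0 t, OF less_imp_le[OF u_dec]] by simp
    have "norm (\<xi> 0 *\<^sub>R N 0) \<le> \<xi> 0 * 2"
      using norm_pt_le[of "m 0" 1] m_le[of 0] m[of 0] \<xi>[of 0] by (simp add: N_def)
    moreover have "norm (v t) \<le> \<bar>u t\<bar> + \<bar>w t\<bar>"
      unfolding v_def using norm_pt_le[of "- ((-1) ^ t * u t)" "w t"]
      by (simp add: abs_mult power_abs)
    moreover have "norm (\<xi> 0 *\<^sub>R N 0 - v t) \<le> norm (\<xi> 0 *\<^sub>R N 0) + norm (v t)"
      by (rule norm_triangle_ineq4)
    ultimately have "norm (\<xi> 0 *\<^sub>R N 0 - v t) \<le> r"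
      using lip0[of t] u[of t] \<open>u t \<le> u 0\<close> by (simp add: r_def)
    then have "norm (\<xi> 0 *\<^sub>R N 0 - v t) powr p \<le> r powr p"
      using p by (intro powr_mono2) auto
    then have "c2 * norm (\<xi> 0 *\<^sub>R N 0 - v t) powr p \<le> \<xi> 0 / (2 * r powr p) * r powr p"
      using \<xi>[of 0] by (intro mult_mono) (auto simp: c2_def)
    also have "\<dots> = \<xi> 0 * (1/2)" using r by simp
    also have "\<dots> \<le> \<xi> 0 * (\<sigma> t * m t * m 0 + 1)"
    proof -
      have "m t * m 0 \<le> (1/2) * (1/2)"
        using m[of 0] m_le by (intro mult_mono) auto
      moreover have "0 < m t * m 0" using m by simp
      ultimately have "1/2 \<le> \<sigma> t * (m t * m 0) + 1" using \<sigma>[of t] by auto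
      then show ?thesis using \<xi>[of 0] by (simp add: mult.assoc)
    qed
    also have "\<dots> = inner (N t) (\<xi> 0 *\<^sub>R N 0)"
      by (simp add: N_def \<sigma>_def algebra_simps)
    also have "\<dots> \<le> inner (N t) (\<xi> 0 *\<^sub>R N 0 - v t)"
    proof -
      have "0 \<le> c1 * norm (0 - v t) powr p" using c by (simp add: c1_def)
      also have "\<dots> \<le> inner (N t) (0 - v t)" using zero[of t] by (simp add: power_cap_def)
      finally show ?thesis by (simp add: inner_diff_right)
    qed
    finally show "\<xi> 0 *\<^sub>R N 0 \<in> power_cap p c2 (N t) (v t)" by (simp add: power_cap_def)
  qed
  have N2: "norm (N t) \<le> 2" for t
    using norm_pt_le[of "(-1) ^ t * m t" 1] m_le[of t] m[of t] by (simp add: N_def abs_mult power_abs)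
  have "convex C" unfolding C_def using convex_power_cap[OF p c2 N2] by (intro convex_INT) auto
  moreover have "compact C"
    unfolding C_def using compact_power_cap[OF _ c2 N2] p by (intro compact_Inter) auto
  moreover have "power_uniformly_convex_set p C"
    unfolding C_def by (rule power_uniformly_convex_INT_power_cap[OF p c2 N2])
  moreover have vertex: "is_arg_min (inner (N t)) (\<lambda>z. z \<in> C) z \<longleftrightarrow> z = v t" for t z
    by (rule power_cap_unique_minimizer[OF c2 vC]) (auto simp: C_def)
  moreover have "frank_wolfe_line_search C (\<lambda>z. K * (norm z)\<^sup>2) (\<xi> 0 *\<^sub>R N 0) x
      \<longleftrightarrow> x = (\<lambda>t. \<xi> t *\<^sub>R N t)" for x
    using frank_wolfe_zigzag[of K m \<xi> u w C x, OF K m \<xi> u foot line inside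
        vertex[unfolded N_def v_def]]
    by (simp only: N_def)
  ultimately show ?thesis using zeroC x0 by blast
qed

end

section \<open>Expansion of the convexity gaps\<close>

text \<open>
  The constant \<open>k\<close> fixes the decay of the slopes, and \<open>a\<close> and \<open>b\<close> the share of the crossing height
  \<open>\<eta>\<close> that is spent on \<open>u\<close>. The choice of \<open>a\<close> cancels the first-order term of the gaps
  (\<open>first_order_cancellation\<close>); the choice of \<open>b\<close> makes the second-order coefficients of the lower
  and of the upper gap equal, hence both positive, since their sum is positive.
\<close>

locale zigzag_exponents =
  fixes p k a b :: real
  assumes p: "p \<ge> 3"
    and k: "k = p / (4 * (p - 1))" and a: "a = p / (p + 1)" and b: "b = - p / (4 * (5 * p - 3))"
begin

lemma k_bounds: "0 < k" "k \<le> 1/2" and a_bounds: "3/4 \<le> a" "a < 1"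
  using p by (auto simp: k a field_simps)

lemma first_order_cancellation: "4 * k + a - 8 * k * a = 0"
  using p by (simp add: k a divide_simps) (simp add: algebra_simps)

text \<open>
  One step of the sequences, from an index whose successor corresponds to the time \<open>\<tau>\<close>, in terms
  of \<open>h = sqrt (1 + 1 / \<tau>) - 1\<close>: then \<open>1 / \<tau> = h * (2 + h)\<close>, and all quantities become rational
  in \<open>h\<close>. The ratio of consecutive crossing heights is \<open>height_ratio h\<close>; the share at the index
  and at its successor are \<open>share h\<close> and \<open>next_share h\<close>.
\<close>

definition height_ratio :: "real \<Rightarrow> real" where
  "height_ratio h = (1 - k * (h * (2 + h)) / (1 + h)) / (1 + k * (h * (2 + h)))"

definition share :: "real \<Rightarrow> real" where
  "share h = a + b * (h * (2 + h))"

definition next_share :: "real \<Rightarrow> real" where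
  "next_share h = a + b * (h * (2 + h)) / (1 + h)\<^sup>2"

text \<open>
  The distance between consecutive first coordinates, in units of \<open>\<eta> / m\<close>.
\<close>

definition step_width :: "real \<Rightarrow> real" where
  "step_width h = share h - height_ratio h * next_share h * (1 + h)"

text \<open>
  The height of the vertex above the tangent at its successor, in units of \<open>\<eta>\<close>.
\<close>

definition convexity_gap :: "real \<Rightarrow> real" where
  "convexity_gap h = 1 - share h - height_ratio h * (1 - next_share h) - step_width h"

text \<open>
  Over the common denominator the constant terms of the numerator cancel, and its linear term
  vanishes by \<open>first_order_cancellation\<close>.
\<close>

lemma convexity_gap_expansion:
  assumes "h > 0"
  shows "convexity_gap h / h\<^sup>2 = ((12*k + 3*a - 26*k*a - 6*b - 16*k*b) + (13*k + 3*a - 31*k*a - 13*b - 44*k*b) * h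
      + (6*k - 16*k*a - 9*b - 56*k*b + a) * h^2 + (k - 3*k*a - 2*b - 39*k*b) * h^3
      - 14*k*b*h^4 - 2*k*b*h^5) / ((1 + h)^3 * (1 + k * (h * (2 + h))))" (is "_ = ?Q / ?den")
proof -
  define d where "d = 1 + k * (h * (2 + h))"
  have d: "d > 0" using assms k_bounds by (auto simp: d_def intro!: add_pos_nonneg)
  have height_ratio: "height_ratio h * ((1 + h) * d) = 1 + h - k * (h * (2 + h))"
    using d assms by (simp add: height_ratio_def flip: d_def) (simp add: field_simps)
  have next_share: "next_share h * (1 + h)\<^sup>2 = a * (1 + h)\<^sup>2 + b * (h * (2 + h))"
    using assms by (simp add: next_share_def field_simps)
  have "convexity_gap h * ((1 + h)^3 * d) = (1 - 2 * share h) * ((1 + h)^3 * d)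
      - (height_ratio h * ((1 + h) * d)) * ((1 + h)\<^sup>2 - (next_share h * (1 + h)\<^sup>2) * (2 + h))"
    by (simp add: convexity_gap_def step_width_def algebra_simps power2_eq_square power3_eq_cube)
  also have "\<dots> = (4 * k + a - 8 * k * a) * h + ?Q * h\<^sup>2"
    unfolding height_ratio next_share unfolding share_def d_def
    by (simp add: algebra_simps eval_nat_numeral)
  also have "\<dots> = ?Q * h\<^sup>2" by (simp add: first_order_cancellation)
  finally have "convexity_gap h * ?den = ?Q * h\<^sup>2"
    by (simp only: d_def)
  then show ?thesis
    using d assms unfolding d_def by (intro iffD2[OF frac_eq_eq]) auto
qed

lemma step_width_expansion:
  assumes "h > 0"
  shows "step_width h / h = ((4*k*a - a) + (10*k*a - 2*a + 2*b + 8*k*b) * h + (8*k*a + 3*b + 16*k*b - a) * h^2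
      + (2*k*a + b + 14*k*b) * h^3 + 6*k*b*h^4 + k*b*h^5) / ((1 + h)^2 * (1 + k * (h * (2 + h))))"
    (is "_ = ?Q / ?den")
proof -
  define d where "d = 1 + k * (h * (2 + h))"
  have d: "d > 0" using assms k_bounds by (auto simp: d_def intro!: add_pos_nonneg)
  have height_ratio: "height_ratio h * ((1 + h) * d) = 1 + h - k * (h * (2 + h))"
    using d assms by (simp add: height_ratio_def flip: d_def) (simp add: field_simps)
  have next_share: "next_share h * (1 + h)\<^sup>2 = a * (1 + h)\<^sup>2 + b * (h * (2 + h))"
    using assms by (simp add: next_share_def field_simps)
  have "step_width h * ((1 + h)^2 * d) = share h * ((1 + h)^2 * d) - (height_ratio h * ((1 + h) * d)) * (next_share h * (1 + h)\<^sup>2)"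
    by (simp add: step_width_def algebra_simps power2_eq_square)
  also have "\<dots> = ?Q * h"
    unfolding height_ratio next_share unfolding share_def d_def
    by (simp add: algebra_simps eval_nat_numeral)
  finally have "step_width h * ?den = ?Q * h"
    by (simp only: d_def)
  then show ?thesis
    using d assms unfolding d_def by (intro iffD2[OF frac_eq_eq]) auto
qed

lemma convexity_gap_limit: "((\<lambda>h. convexity_gap h / h\<^sup>2) \<longlongrightarrow> p / (2 * (p\<^sup>2 - 1))) (at_right 0)"
proof -
  have "((\<lambda>h. ((12*k + 3*a - 26*k*a - 6*b - 16*k*b) + (13*k + 3*a - 31*k*a - 13*b - 44*k*b) * h
      + (6*k - 16*k*a - 9*b - 56*k*b + a) * h^2 + (k - 3*k*a - 2*b - 39*k*b) * h^3
      - 14*k*b*h^4 - 2*k*b*h^5) / ((1 + h)^3 * (1 + k * (h * (2 + h)))))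
      \<longlongrightarrow> 12*k + 3*a - 26*k*a - 6*b - 16*k*b) (at_right 0)"
    by (auto intro!: tendsto_eq_intros)
  moreover have "12*k + 3*a - 26*k*a - 6*b - 16*k*b = p / (2 * (p\<^sup>2 - 1))"
  proof -
    have "12*k + 3*a - 26*k*a - 6*b - 16*k*b = - k - a / 4 - b * (6 + 16 * k)"
      using first_order_cancellation by (simp add: algebra_simps)
    also have "k + a / 4 = p\<^sup>2 / (2 * (p\<^sup>2 - 1))"
    proof -
      have "p\<^sup>2 - 1 = (p - 1) * (p + 1)" by (simp add: algebra_simps power2_eq_square)
      then show ?thesis using p by (simp add: k a divide_simps) (simp add: algebra_simps power2_eq_square)
    qed
    then have "- k - a / 4 = - (p\<^sup>2 / (2 * (p\<^sup>2 - 1)))" by simp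
    also have "b * (6 + 16 * k) = - (p / (2 * (p - 1)))"
    proof -
      have "6 + 16 * k = 2 * (5 * p - 3) / (p - 1)" using p by (simp add: k divide_simps) (simp add: algebra_simps)
      moreover have "- p / (4 * r) * (2 * r / (p - 1)) = - (p / (2 * (p - 1)))" if "r > 0" for r
        using that p by (simp add: field_simps)
      ultimately show ?thesis using p by (simp only: b)
    qed
    also have "- (p\<^sup>2 / (2 * (p\<^sup>2 - 1))) - - (p / (2 * (p - 1))) = p / (2 * (p\<^sup>2 - 1))"
    proof -
      have "p\<^sup>2 - 1 = (p - 1) * (p + 1)" by (simp add: algebra_simps power2_eq_square)
      then show ?thesis using p by (simp add: divide_simps) (simp add: algebra_simps power2_eq_square)
    qed
    finally show ?thesis .
  qed
  ultimately show ?thesis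
    by (subst filterlim_cong[OF refl refl, of _ _ "at_right 0"])
       (auto simp: eventually_at_filter convexity_gap_expansion)
qed

lemma step_width_limit: "((\<lambda>h. step_width h / h) \<longlongrightarrow> p / (p\<^sup>2 - 1)) (at_right 0)"
proof -
  have "((\<lambda>h. ((4*k*a - a) + (10*k*a - 2*a + 2*b + 8*k*b) * h + (8*k*a + 3*b + 16*k*b - a) * h^2
      + (2*k*a + b + 14*k*b) * h^3 + 6*k*b*h^4 + k*b*h^5) / ((1 + h)^2 * (1 + k * (h * (2 + h)))))
      \<longlongrightarrow> 4*k*a - a) (at_right 0)"
    by (auto intro!: tendsto_eq_intros)
  moreover have "4*k*a - a = p / (p\<^sup>2 - 1)"
  proof -
    have "p\<^sup>2 - 1 = (p - 1) * (p + 1)" by (simp add: algebra_simps power2_eq_square)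
    then show ?thesis using p by (simp add: k a divide_simps) (simp add: algebra_simps)
  qed
  ultimately show ?thesis
    by (subst filterlim_cong[OF refl refl, of _ _ "at_right 0"])
       (auto simp: eventually_at_filter step_width_expansion)
qed

text \<open>
  The second expression bounds from below the height of the successor above the tangent at the
  vertex, which in units of \<open>\<eta>\<close> is \<open>(m t / m (Suc t) - 1) * step_width h - convexity_gap h\<close> with
  \<open>m t / m (Suc t) \<ge> 1 + h * (2 + h) / 2\<close>. Divided by \<open>h\<^sup>2\<close>, both expressions tend to half the limit
  \<open>p / (p\<^sup>2 - 1)\<close> of \<open>step_width h / h\<close>, and \<open>\<delta>\<close> is half of that again.
\<close>

lemma eventually_margins:
  defines "\<delta> \<equiv> p / (4 * (p\<^sup>2 - 1))"
  shows "eventually (\<lambda>h. \<delta> * h\<^sup>2 \<le> convexity_gap h \<and> \<delta> * h\<^sup>2 \<le> h * (2 + h) / 2 * step_width h - convexity_gap h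
    \<and> 0 < step_width h \<and> step_width h \<le> h \<and> 1/2 \<le> share h \<and> share h \<le> 1) (at_right 0)"
proof -
  have p2: "p\<^sup>2 - 1 > p"
  proof -
    have "3 * p \<le> p * p" using p by (intro mult_right_mono) auto
    then show ?thesis using p unfolding power2_eq_square by linarith
  qed
  define Q where "Q = p / (p\<^sup>2 - 1)"
  have q: "0 < Q" "Q < 1" using p p2 by (auto simp: Q_def field_simps)
  have \<delta>: "\<delta> = Q / 4"
    unfolding \<delta>_def Q_def by (rule divide_divide_eq_left'[symmetric])
  have convexity_gap_lim: "((\<lambda>h. convexity_gap h / h\<^sup>2) \<longlongrightarrow> Q / 2) (at_right 0)"
    unfolding Q_def divide_divide_eq_left' by (rule convexity_gap_limit)
  have step_width_lim: "((\<lambda>h. step_width h / h) \<longlongrightarrow> Q) (at_right 0)"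
    unfolding Q_def by (rule step_width_limit)
  have h0: "eventually (\<lambda>h::real. 0 < h) (at_right 0)" by (rule eventually_at_right_less)
  have "eventually (\<lambda>h. \<delta> < convexity_gap h / h\<^sup>2) (at_right 0)"
    by (rule order_tendstoD(1)[OF convexity_gap_lim]) (use q in \<open>simp add: \<delta>\<close>)
  moreover have "((\<lambda>h. (1 + h / 2) * (step_width h / h) - convexity_gap h / h\<^sup>2) \<longlongrightarrow> (1 + 0 / 2) * Q - Q / 2) (at_right 0)"
    by (intro tendsto_intros convexity_gap_lim step_width_lim) auto
  then have "eventually (\<lambda>h. \<delta> < (1 + h / 2) * (step_width h / h) - convexity_gap h / h\<^sup>2) (at_right 0)"
    by (rule order_tendstoD(1)) (use q in \<open>simp add: \<delta>\<close>)
  moreover have "eventually (\<lambda>h. 0 < step_width h / h) (at_right 0)" "eventually (\<lambda>h. step_width h / h < 1) (at_right 0)"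
    by (rule order_tendstoD[OF step_width_lim]; use q in auto)+
  moreover have "(share \<longlongrightarrow> a) (at_right 0)"
    unfolding share_def by (auto intro!: tendsto_eq_intros)
  then have "eventually (\<lambda>h. 1/2 < share h) (at_right 0)" "eventually (\<lambda>h. share h < 1) (at_right 0)"
    by (rule order_tendstoD; use a_bounds in simp)+
  ultimately show ?thesis
    using h0
  proof eventually_elim
    case (elim h)
    have "(1 + h / 2) * (step_width h / h) - convexity_gap h / h\<^sup>2 = (h * (2 + h) / 2 * step_width h - convexity_gap h) / h\<^sup>2"
      using elim by (simp add: field_simps power2_eq_square)
    then show ?case
      using elim by (auto simp: pos_less_divide_eq zero_less_divide_iff)
  qed
qed

text \<open>
  The logarithmic increment of \<open>\<xi> t * \<tau> t powr (2 * k)\<close> as a function of \<open>\<tau> t\<close>; the terms of order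
  \<open>1 / x\<close> cancel.
\<close>

lemma log_increment_bigo:
  "(\<lambda>x. ln (1 - k / sqrt (x * (x + 1))) - ln (1 + k / (x + 1)) + 2 * k * (ln (x + 1) - ln x))
    \<in> O(\<lambda>x::real. 1 / x^2)"
  using k_bounds(1) by real_asymp

end

section \<open>The slopes, the heights and the vertices\<close>

text \<open>
  The shift \<open>N\<close> of time starts the sequences where the asymptotic margins are in force.
\<close>

locale zigzag_sequences = zigzag_exponents +
  fixes N :: nat and \<delta> :: real
  assumes N: "N \<ge> 2" and \<delta>: "\<delta> > 0"
    and margins: "\<And>n h. n \<ge> real N \<Longrightarrow> h = sqrt (1 + 1 / n) - 1 \<Longrightarrow>
      \<delta> * h\<^sup>2 \<le> convexity_gap h \<and> \<delta> * h\<^sup>2 \<le> h * (2 + h) / 2 * step_width h - convexity_gap h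
      \<and> 0 < step_width h \<and> step_width h \<le> h \<and> 1/2 \<le> share h \<and> share h \<le> 1"
begin

definition \<tau> :: "nat \<Rightarrow> real" where "\<tau> t = real (t + N)"

definition m :: "nat \<Rightarrow> real" where "m t = sqrt (k / \<tau> t)"

primrec \<xi> :: "nat \<Rightarrow> real" where
  "\<xi> 0 = 1"
| "\<xi> (Suc t) = \<xi> t * (1 - m t * m (Suc t)) / (1 + (m (Suc t))\<^sup>2)"

text \<open>
  The height at which the line through \<open>\<xi> t *\<^sub>R N t\<close> and \<open>v t\<close> crosses the axis.
\<close>

definition \<eta> :: "nat \<Rightarrow> real" where "\<eta> t = \<xi> t * (1 - m t * m (Suc t))"

definition h :: "nat \<Rightarrow> real" where "h t = sqrt (1 + 1 / \<tau> (Suc t)) - 1"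

definition u :: "nat \<Rightarrow> real" where "u t = \<eta> t * share (h t) / m (Suc t)"

definition w :: "nat \<Rightarrow> real" where "w t = \<eta> t * (1 - share (h t))"

lemma \<tau>_ge: "2 \<le> \<tau> t" and \<tau>_pos: "0 < \<tau> t" and \<tau>_Suc: "\<tau> (Suc t) = \<tau> t + 1"
  using N by (auto simp: \<tau>_def)

lemma m_pos: "0 < m t" and m_sq: "(m t)\<^sup>2 = k / \<tau> t"
  using k_bounds \<tau>_pos[of t] by (auto simp: m_def)

lemma m_le: "m t \<le> 1/2"
proof -
  have "k / \<tau> t \<le> (1/2) / 2"
    using k_bounds \<tau>_ge[of t] by (intro frac_le) auto
  then have "(m t)\<^sup>2 \<le> (1/2)\<^sup>2" unfolding m_sq by (simp add: power2_eq_square)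
  then show ?thesis by (rule power2_le_imp_le) simp
qed

lemma m_prod_le: "m t * m s \<le> 1/4"
proof -
  have "m t * m s \<le> (1/2) * (1/2)" using m_le m_pos[of s] by (intro mult_mono) auto
  then show ?thesis by simp
qed

lemma \<xi>_pos: "0 < \<xi> t"
proof (induction t)
  case (Suc t)
  have "m t * m (Suc t) < 1" using m_prod_le[of t "Suc t"] by linarith
  then show ?case using Suc by (auto intro!: divide_pos_pos mult_pos_pos add_pos_nonneg)
qed simp

lemma \<eta>_pos: "0 < \<eta> t" and \<eta>_le: "\<eta> t \<le> \<xi> t"
proof -
  have "m t * m (Suc t) < 1" using m_prod_le[of t "Suc t"] by linarith
  then show "0 < \<eta> t" using \<xi>_pos by (simp add: \<eta>_def)
  have "\<xi> t * (1 - m t * m (Suc t)) \<le> \<xi> t * 1"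
    using m_pos[of t] m_pos[of "Suc t"] \<xi>_pos[of t] by (intro mult_left_mono) auto
  then show "\<eta> t \<le> \<xi> t" by (simp add: \<eta>_def)
qed

lemma foot: "\<xi> (Suc t) * (1 + (m (Suc t))\<^sup>2) = \<eta> t"
proof -
  have "1 + (m (Suc t))\<^sup>2 > 0" by (intro add_pos_nonneg) auto
  then show ?thesis by (simp add: \<eta>_def)
qed

lemma line: "u t * m (Suc t) + w t = \<eta> t"
  using m_pos[of "Suc t"] by (simp add: u_def w_def algebra_simps)

lemma h_pos: "0 < h t"
  using \<tau>_pos[of "Suc t"] by (simp add: h_def)

lemma h_sq: "(1 + h t)\<^sup>2 = 1 + 1 / \<tau> (Suc t)"
  using \<tau>_pos[of "Suc t"] by (simp add: h_def add_nonneg_nonneg)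

lemma h_eq: "h t * (2 + h t) = 1 / \<tau> (Suc t)"
  using h_sq[of t] by (simp add: power2_eq_square algebra_simps)

lemma margins_at:
  shows "\<delta> * (h t)\<^sup>2 \<le> convexity_gap (h t)" "\<delta> * (h t)\<^sup>2 \<le> h t * (2 + h t) / 2 * step_width (h t) - convexity_gap (h t)"
    "0 < step_width (h t)" "step_width (h t) \<le> h t" "1/2 \<le> share (h t)" "share (h t) \<le> 1"
  using margins[of "\<tau> (Suc t)" "h t"] by (auto simp: h_def \<tau>_def)

lemma m_Suc: "m (Suc (Suc t)) * (1 + h t) = m (Suc t)"
proof -
  have "\<tau> (Suc (Suc t)) = \<tau> (Suc t) * (1 + h t)\<^sup>2"
    unfolding h_sq using \<tau>_pos[of "Suc t"] by (simp add: \<tau>_Suc[of "Suc t"] algebra_simps)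
  then have "(m (Suc (Suc t)) * (1 + h t))\<^sup>2 = (m (Suc t))\<^sup>2"
    using h_pos[of t] \<tau>_pos[of "Suc t"] unfolding power_mult_distrib m_sq by simp
  then show ?thesis
    by (rule power2_eq_imp_eq) (use m_pos[of "Suc t"] m_pos[of "Suc (Suc t)"] h_pos[of t] in simp_all)
qed

lemma share_Suc: "share (h (Suc t)) = next_share (h t)"
proof -
  have "\<tau> (Suc (Suc t)) = \<tau> (Suc t) * (1 + h t)\<^sup>2"
    unfolding h_sq using \<tau>_pos[of "Suc t"] by (simp add: \<tau>_Suc[of "Suc t"] algebra_simps)
  then show ?thesis
    unfolding share_def next_share_def h_eq by simp
qed

lemma \<eta>_Suc: "\<eta> (Suc t) = \<eta> t * height_ratio (h t)"
proof -
  have k: "k * (h t * (2 + h t)) = (m (Suc t))\<^sup>2"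
    unfolding h_eq m_sq by simp
  have "\<eta> (Suc t) = \<xi> (Suc t) * (1 - m (Suc t) * m (Suc (Suc t)))"
    by (rule \<eta>_def)
  also have "\<xi> (Suc t) = \<eta> t / (1 + (m (Suc t))\<^sup>2)"
    by (simp add: \<eta>_def)
  also have "m (Suc (Suc t)) = m (Suc t) / (1 + h t)"
    using m_Suc[of t] h_pos[of t] by (simp add: field_simps)
  finally show ?thesis
    unfolding height_ratio_def k by (simp add: power2_eq_square)
qed

lemma u_diff: "u t - u (Suc t) = \<eta> t * step_width (h t) / m (Suc t)"
proof -
  have "u (Suc t) = \<eta> t * height_ratio (h t) * next_share (h t) / m (Suc (Suc t))"
    by (simp only: u_def \<eta>_Suc share_Suc)
  also have "\<dots> = \<eta> t * height_ratio (h t) * next_share (h t) * (1 + h t) / m (Suc t)"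
    unfolding m_Suc[of t, symmetric] using h_pos[of t] by simp
  finally show ?thesis
    by (simp add: u_def step_width_def right_diff_distrib diff_divide_distrib mult_ac)
qed

lemma lower_gap: "w t - w (Suc t) - m (Suc t) * (u t - u (Suc t)) = \<eta> t * convexity_gap (h t)"
  unfolding u_diff using m_pos[of "Suc t"]
  by (simp add: w_def \<eta>_Suc share_Suc convexity_gap_def algebra_simps)

lemma m_ratio: "m (Suc t) * (1 + h t * (2 + h t) / 2) \<le> m t"
proof -
  define n where "n = \<tau> (Suc t)"
  have n: "n > 1" using \<tau>_ge[of t] by (simp add: n_def \<tau>_Suc)
  have "(1 + 1 / n / 2)\<^sup>2 * (n - 1) \<le> n"
    using n by (simp add: power2_eq_square field_simps)
  then have "k * ((1 + 1 / n / 2)\<^sup>2 * (n - 1)) \<le> k * n"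
    using k_bounds by (intro mult_left_mono) auto
  then have "k / n * (1 + 1 / n / 2)\<^sup>2 \<le> k / (n - 1)"
    using n by (simp add: field_simps)
  then have "(m (Suc t) * (1 + 1 / n / 2))\<^sup>2 \<le> (m t)\<^sup>2"
    unfolding power_mult_distrib m_sq by (simp add: n_def \<tau>_Suc)
  then show ?thesis
    unfolding h_eq n_def[symmetric] using m_pos[of t] by - (rule power2_le_imp_le, simp_all)
qed

lemma upper_gap: "w (Suc t) - w t - m t * (u (Suc t) - u t)
  \<ge> \<eta> t * (h t * (2 + h t) / 2 * step_width (h t) - convexity_gap (h t))"
proof -
  have "m (Suc t) * (1 + h t * (2 + h t) / 2) * (\<eta> t * step_width (h t) / m (Suc t)) \<le> m t * (\<eta> t * step_width (h t) / m (Suc t))"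
    using m_ratio m_pos[of "Suc t"] \<eta>_pos[of t] margins_at(3)[of t]
    by (intro mult_right_mono) auto
  then have "(1 + h t * (2 + h t) / 2) * (\<eta> t * step_width (h t)) \<le> m t * (u t - u (Suc t))"
    unfolding u_diff using m_pos[of "Suc t"] by simp
  moreover have "w t - w (Suc t) = \<eta> t * convexity_gap (h t) + \<eta> t * step_width (h t)"
    using lower_gap[of t] m_pos[of "Suc t"] unfolding u_diff by (simp add: algebra_simps)
  ultimately show ?thesis by (simp add: algebra_simps)
qed

lemma u_pos: "0 < u t" and u_dec: "u (Suc t) < u t"
proof -
  show "0 < u t"
    using \<eta>_pos[of t] m_pos[of "Suc t"] margins_at(5)[of t] by (simp add: u_def)
  have "0 < u t - u (Suc t)"
    unfolding u_diff using \<eta>_pos[of t] m_pos[of "Suc t"] margins_at(3)[of t] by simp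
  then show "u (Suc t) < u t" by simp
qed

text \<open>
  As \<open>u t\<close> is at least \<open>\<eta> t / (2 * m (Suc t))\<close>, it exceeds the first coordinate of the next iterate,
  which is of the smaller order \<open>\<eta> t * m (Suc t)\<close>.
\<close>

lemma inside: "\<xi> (Suc t) * m (Suc t) \<le> u t"
proof -
  have "(m (Suc t))\<^sup>2 \<le> (1/2)\<^sup>2" using m_le m_pos[of "Suc t"] by (intro power_mono) auto
  also have "\<dots> \<le> 1/2 * 1" by (simp add: power2_eq_square)
  also have "\<dots> \<le> share (h t) * (1 + (m (Suc t))\<^sup>2)"
    using margins_at(5)[of t] by (intro mult_mono) auto
  finally have "\<xi> (Suc t) * (m (Suc t))\<^sup>2 \<le> \<xi> (Suc t) * (share (h t) * (1 + (m (Suc t))\<^sup>2))"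
    using \<xi>_pos[of "Suc t"] by (intro mult_left_mono) simp_all
  also have "\<dots> = u t * m (Suc t)"
  proof -
    have "u t * m (Suc t) = \<eta> t * share (h t)" using m_pos[of "Suc t"] by (simp add: u_def)
    also have "\<dots> = \<xi> (Suc t) * (1 + (m (Suc t))\<^sup>2) * share (h t)" by (simp only: foot)
    finally show ?thesis by (simp only: mult_ac)
  qed
  finally have "(\<xi> (Suc t) * m (Suc t)) * m (Suc t) \<le> u t * m (Suc t)"
    by (simp add: power2_eq_square mult.assoc)
  then show ?thesis using m_pos[of "Suc t"] by (simp del: \<xi>.simps)
qed

text \<open>
  The logarithm of the product telescopes with summable increments.
\<close>

lemma \<xi>_asymptotics: "\<exists>l>0. (\<lambda>t. \<xi> t * \<tau> t powr (2 * k)) \<longlonglongrightarrow> l"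
proof -
  define g where "g x = ln (1 - k / sqrt (x * (x + 1))) - ln (1 + k / (x + 1)) + 2 * k * (ln (x + 1) - ln x)" for x
  define Y where "Y t = ln (\<xi> t * \<tau> t powr (2 * k))" for t
  have Y_diff: "Y (Suc t) - Y t = g (\<tau> t)" for t
  proof -
    have mm: "m t * m (Suc t) = k / sqrt (\<tau> t * (\<tau> t + 1))"
      using k_bounds by (simp add: m_def \<tau>_Suc real_sqrt_divide real_sqrt_mult)
    have pos: "0 < 1 - m t * m (Suc t)" "0 < 1 + (m (Suc t))\<^sup>2"
      using m_prod_le[of t "Suc t"] by (auto intro: add_pos_nonneg)
    have ln_Y: "Y s = ln (\<xi> s) + 2 * k * ln (\<tau> s)" for s
      unfolding Y_def using \<xi>_pos[of s] \<tau>_pos[of s]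
      by (subst ln_mult) (auto simp del: \<xi>.simps simp: ln_powr)
    have "ln (\<xi> (Suc t)) = ln (\<xi> t) + ln (1 - m t * m (Suc t)) - ln (1 + (m (Suc t))\<^sup>2)"
      using \<xi>_pos[of t] pos by (simp add: ln_mult ln_div)
    then show ?thesis
      unfolding g_def ln_Y mm m_sq \<tau>_Suc by (simp add: algebra_simps)
  qed
  have "summable (\<lambda>t. norm (1 / (real t)\<^sup>2))"
    using inverse_power_summable[of 2, where 'a = real] by (simp add: inverse_eq_divide)
  then have "summable (\<lambda>t. norm (1 / (real (t + N))\<^sup>2))"
    by (subst summable_iff_shift)
  moreover have "(\<lambda>t. g (\<tau> t)) \<in> O(\<lambda>t. 1 / (real (t + N))\<^sup>2)"
  proof -
    have "filterlim (\<lambda>t. real (t + N)) at_top sequentially"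
      by real_asymp
    from landau_o.big.compose[OF log_increment_bigo this]
    show ?thesis by (simp add: g_def \<tau>_def)
  qed
  ultimately have "summable (\<lambda>t. g (\<tau> t))"
    by (rule summable_comparison_test_bigo)
  then have "(\<lambda>n. \<Sum>t<n. g (\<tau> t)) \<longlonglongrightarrow> (\<Sum>t. g (\<tau> t))"
    by (rule summable_LIMSEQ)
  moreover have "(\<Sum>t<n. g (\<tau> t)) = Y n - Y 0" for n
    unfolding Y_diff[symmetric] by (rule sum_lessThan_telescope)
  ultimately have "(\<lambda>n. (Y n - Y 0) + Y 0) \<longlonglongrightarrow> (\<Sum>t. g (\<tau> t)) + Y 0"
    by (intro tendsto_intros) simp
  then have "(\<lambda>n. exp (Y n)) \<longlonglongrightarrow> exp ((\<Sum>t. g (\<tau> t)) + Y 0)"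
    by (intro tendsto_exp) simp
  moreover have "exp (Y n) = \<xi> n * \<tau> n powr (2 * k)" for n
    unfolding Y_def using \<xi>_pos[of n] \<tau>_pos[of n] by simp
  ultimately show ?thesis by (intro exI[of _ "exp ((\<Sum>t. g (\<tau> t)) + Y 0)"]) simp
qed

end

section \<open>Margins of uniform convexity and the rate\<close>

context zigzag_sequences
begin

lemma \<xi>_bound: "\<exists>B>0. \<forall>t. \<xi> t \<le> B * \<tau> t powr (- 2 * k)"
proof -
  have "Bseq (\<lambda>t. \<xi> t * \<tau> t powr (2 * k))"
    using \<xi>_asymptotics by (auto intro: convergent_imp_Bseq convergentI)
  then obtain B where B: "B > 0" "\<And>t. norm (\<xi> t * \<tau> t powr (2 * k)) \<le> B"
    by (auto elim: BseqE)
  have "\<xi> t \<le> B * \<tau> t powr (- 2 * k)" for t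
  proof -
    have "\<xi> t * \<tau> t powr (2 * k) \<le> B" using B(2)[of t] by simp
    then have "\<xi> t \<le> B / \<tau> t powr (2 * k)" using \<tau>_pos[of t] by (simp add: pos_le_divide_eq)
    then show ?thesis by (simp add: powr_minus divide_inverse)
  qed
  then show ?thesis using B(1) by blast
qed

lemma m_le_2_m_Suc: "m t \<le> 2 * m (Suc t)"
proof -
  have "k / \<tau> t \<le> 4 * (k / \<tau> (Suc t))"
    using \<tau>_ge[of t] k_bounds unfolding \<tau>_Suc by (simp add: field_simps)
  then have "(m t)\<^sup>2 \<le> (2 * m (Suc t))\<^sup>2"
    by (simp add: power_mult_distrib m_sq)
  then show ?thesis by (rule power2_le_imp_le) (use m_pos[of "Suc t"] in simp)
qed

text \<open>
  Since \<open>u\<close> is of order \<open>\<xi> / m\<close>, its exponent is \<open>1/2 - 2 * k = - 1 / (2 * (p - 1))\<close>.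
\<close>

lemma u_bound: "\<exists>B>0. \<forall>t. u t \<le> B * \<tau> t powr (- (1 / (2 * (p - 1))))"
proof -
  obtain B where B: "B > 0" "\<And>t. \<xi> t \<le> B * \<tau> t powr (- 2 * k)" using \<xi>_bound by blast
  have e: "- 2 * k + 1/2 = - (1 / (2 * (p - 1)))"
    using p by (simp add: k divide_simps)
  have "u t \<le> (2 * B / sqrt k) * \<tau> t powr (- (1 / (2 * (p - 1))))" for t
  proof -
    have "\<eta> t * share (h t) \<le> \<xi> t * 1"
      using \<eta>_le \<eta>_pos[of t] \<xi>_pos[of t] margins_at(5,6)[of t] by (intro mult_mono) auto
    then have "u t \<le> \<xi> t / m (Suc t)"
      using m_pos[of "Suc t"] by (simp add: u_def divide_right_mono)
    also have "\<dots> \<le> \<xi> t / (m t / 2)"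
      using m_le_2_m_Suc[of t] m_pos[of t] m_pos[of "Suc t"] \<xi>_pos[of t]
      by (intro divide_left_mono) auto
    also have "\<dots> = 2 * \<xi> t * sqrt (\<tau> t) / sqrt k"
      by (simp add: m_def real_sqrt_divide)
    also have "\<dots> \<le> 2 * (B * \<tau> t powr (- 2 * k)) * sqrt (\<tau> t) / sqrt k"
      using B(2)[of t] k_bounds \<tau>_pos[of t]
      by (intro divide_right_mono mult_right_mono mult_left_mono) auto
    also have "sqrt (\<tau> t) = \<tau> t powr (1/2)"
      using \<tau>_pos[of t] by (simp add: powr_half_sqrt)
    also have "2 * (B * \<tau> t powr (- 2 * k)) * \<tau> t powr (1/2) / sqrt k
        = (2 * B / sqrt k) * \<tau> t powr (- 2 * k + 1/2)"
      unfolding powr_add by simp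
    finally show ?thesis unfolding e .
  qed
  moreover have "2 * B / sqrt k > 0" using B k_bounds by simp
  ultimately show ?thesis by blast
qed

lemma \<tau>_powr_lim: "s > 0 \<Longrightarrow> (\<lambda>t. \<tau> t powr (- s)) \<longlonglongrightarrow> 0"
  unfolding \<tau>_def by real_asymp

lemma \<xi>_lim: "\<xi> \<longlonglongrightarrow> 0"
proof -
  obtain B where B: "B > 0" "\<And>t. \<xi> t \<le> B * \<tau> t powr (- 2 * k)" using \<xi>_bound by blast
  have "(\<lambda>t. B * \<tau> t powr (- (2 * k))) \<longlonglongrightarrow> B * 0"
    using k_bounds by (intro tendsto_mult tendsto_const \<tau>_powr_lim) auto
  then have *: "(\<lambda>t. B * \<tau> t powr (- 2 * k)) \<longlonglongrightarrow> 0" by simp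
  show ?thesis
    by (rule tendsto_sandwich[OF _ _ tendsto_const *])
       (use B \<xi>_pos in \<open>auto intro!: always_eventually less_imp_le[OF \<xi>_pos]\<close>)
qed

lemma u_lim: "u \<longlonglongrightarrow> 0"
proof -
  obtain B where B: "B > 0" "\<And>t. u t \<le> B * \<tau> t powr (- (1 / (2 * (p - 1))))" using u_bound by blast
  have "(\<lambda>t. B * \<tau> t powr (- (1 / (2 * (p - 1))))) \<longlonglongrightarrow> B * 0"
    using p by (intro tendsto_mult tendsto_const \<tau>_powr_lim) auto
  then have *: "(\<lambda>t. B * \<tau> t powr (- (1 / (2 * (p - 1))))) \<longlonglongrightarrow> 0" by simp
  show ?thesis
    by (rule tendsto_sandwich[OF _ _ tendsto_const *])
       (use B in \<open>auto intro!: always_eventually less_imp_le[OF u_pos]\<close>)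
qed

lemma w_lim: "w \<longlonglongrightarrow> 0"
proof -
  have "0 \<le> w t" and "w t \<le> \<xi> t" for t
  proof -
    show "0 \<le> w t" using \<eta>_pos[of t] margins_at(6)[of t] by (simp add: w_def)
    have "w t \<le> \<eta> t * 1" unfolding w_def
      using \<eta>_pos[of t] margins_at(5)[of t] by (intro mult_left_mono) auto
    then show "w t \<le> \<xi> t" using \<eta>_le[of t] by simp
  qed
  then show ?thesis
    by (intro tendsto_sandwich[OF _ _ tendsto_const \<xi>_lim] always_eventually) auto
qed

text \<open>
  The slope at a vertex dominates a multiple of the derivative of \<open>\<lambda>u. u powr p\<close>, because by the
  choice of \<open>k\<close> both are at most of order \<open>\<tau> t powr (- 1/2)\<close>, and the slope is exactly of this order.
\<close>

lemma u_powr_bound: "\<exists>B>0. \<forall>t. u t powr (p - 1) \<le> B * m t"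
proof -
  obtain B where B: "B > 0" "\<And>t. u t \<le> B * \<tau> t powr (- (1 / (2 * (p - 1))))" using u_bound by blast
  have "u t powr (p - 1) \<le> (B powr (p - 1) / sqrt k) * m t" for t
  proof -
    have "u t powr (p - 1) \<le> (B * \<tau> t powr (- (1 / (2 * (p - 1))))) powr (p - 1)"
      using B(2)[of t] u_pos[of t] p by (intro powr_mono2) auto
    also have "\<dots> = B powr (p - 1) * \<tau> t powr (- (1 / (2 * (p - 1))) * (p - 1))"
      using B(1) \<tau>_pos[of t] by (simp add: powr_mult powr_powr)
    also have "- (1 / (2 * (p - 1))) * (p - 1) = - (1/2)"
      using p by (simp add: field_simps)
    also have "\<tau> t powr - (1/2) = 1 / sqrt (\<tau> t)"
      using \<tau>_pos[of t] by (simp add: powr_minus powr_half_sqrt inverse_eq_divide)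
    also have "B powr (p - 1) * (1 / sqrt (\<tau> t)) = (B powr (p - 1) / sqrt k) * m t"
      using k_bounds by (simp add: m_def real_sqrt_divide)
    finally show ?thesis .
  qed
  moreover have "B powr (p - 1) / sqrt k > 0" using B k_bounds by simp
  ultimately show ?thesis by blast
qed

text \<open>
  Consecutive vertices differ by a relative amount of at most \<open>2 * h t\<close>, so the divergences of
  \<open>\<lambda>u. u powr p\<close> between them are at most of order \<open>u t powr p * (h t)\<^sup>2\<close>, and
  \<open>u t powr p\<close> is at most of order \<open>m t * u t\<close>, hence of order \<open>\<eta> t\<close>. This is the order of
  the margins.
\<close>

lemma uniform_convexity_margin:
  "\<exists>c>0. \<forall>t. c * (p * u t powr (p - 1)) \<le> m t
    \<and> c * (u (Suc t) powr p - u t powr p - p * u t powr (p - 1) * (u (Suc t) - u t))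
      \<le> w (Suc t) - w t - m t * (u (Suc t) - u t)
    \<and> c * (u t powr p - u (Suc t) powr p - p * u (Suc t) powr (p - 1) * (u t - u (Suc t)))
      \<le> w t - w (Suc t) - m (Suc t) * (u t - u (Suc t))"
proof -
  obtain B where B: "B > 0" "\<And>t. u t powr (p - 1) \<le> B * m t" using u_powr_bound by blast
  define c where "c = min (1 / (p * B)) (\<delta> / (8 * p * (p - 1) * B))"
  have c: "c > 0" using B(1) \<delta> p by (simp add: c_def)
  have slope: "c * (p * u t powr (p - 1)) \<le> m t" for t
  proof -
    have "c * (p * u t powr (p - 1)) \<le> 1 / (p * B) * (p * (B * m t))"
      using B p m_pos[of t] by (intro mult_mono) (auto simp: c_def)
    then show ?thesis using B p by simp
  qed
  have Bregman: "c * (x powr p - y powr p - p * y powr (p - 1) * (x - y)) \<le> \<eta> t * (\<delta> * (h t)\<^sup>2)"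
    if xy: "x = u t \<and> y = u (Suc t) \<or> x = u (Suc t) \<and> y = u t" for x y t
  proof -
    have diff: "u t - u (Suc t) \<le> u t * (2 * h t)"
    proof -
      have "u t - u (Suc t) = \<eta> t / m (Suc t) * step_width (h t)" by (simp add: u_diff)
      also have "\<dots> \<le> \<eta> t / m (Suc t) * (share (h t) * (2 * h t))"
      proof (intro mult_left_mono)
        have "1/2 * (2 * h t) \<le> share (h t) * (2 * h t)"
          using margins_at(5)[of t] h_pos[of t] by (intro mult_right_mono) auto
        then show "step_width (h t) \<le> share (h t) * (2 * h t)" using margins_at(4)[of t] by simp
      qed (use \<eta>_pos[of t] m_pos[of "Suc t"] in simp)
      also have "\<dots> = u t * (2 * h t)" by (simp add: u_def)
      finally show ?thesis .
    qed
    have "(x - y)\<^sup>2 = (u t - u (Suc t))\<^sup>2" using xy by (auto simp: power2_commute)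
    also have "\<dots> \<le> (u t * (2 * h t))\<^sup>2"
      using diff u_dec[of t] by (intro power_mono) auto
    finally have xy2: "(x - y)\<^sup>2 \<le> (u t)\<^sup>2 * (4 * (h t)\<^sup>2)" by (simp add: power_mult_distrib)
    have powr_p: "u t powr (p - 2) * (u t)\<^sup>2 = u t powr (p - 1) * u t"
    proof -
      have "u t powr (p - 2) * u t powr 2 = u t powr (p - 1) * u t powr 1"
        unfolding powr_add[symmetric] by simp
      then show ?thesis using u_pos[of t] by simp
    qed
    have mu: "m t * u t \<le> 2 * \<eta> t"
    proof -
      have "m t * u t \<le> 2 * m (Suc t) * u t"
        using m_le_2_m_Suc[of t] u_pos[of t] by (intro mult_right_mono) auto
      also have "\<dots> = 2 * \<eta> t * share (h t)" using m_pos[of "Suc t"] by (simp add: u_def)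
      also have "\<dots> \<le> 2 * \<eta> t * 1"
        using margins_at(6)[of t] \<eta>_pos[of t] by (intro mult_left_mono) auto
      finally show ?thesis by simp
    qed
    have "x powr p - y powr p - p * y powr (p - 1) * (x - y)
        \<le> p * (p - 1) * u t powr (p - 2) * (x - y)\<^sup>2"
      using xy u_dec[of t] u_pos[of t] u_pos[of "Suc t"] p by (intro powr_Bregman_upper_bound) auto
    also have "\<dots> \<le> p * (p - 1) * u t powr (p - 2) * ((u t)\<^sup>2 * (4 * (h t)\<^sup>2))"
      using xy2 p by (intro mult_left_mono) auto
    also have "\<dots> = 4 * p * (p - 1) * (h t)\<^sup>2 * (u t powr (p - 2) * (u t)\<^sup>2)"
      by (simp add: mult_ac)
    also have "\<dots> = 4 * p * (p - 1) * (h t)\<^sup>2 * (u t powr (p - 1) * u t)"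
      by (simp only: powr_p)
    also have "\<dots> \<le> 4 * p * (p - 1) * (h t)\<^sup>2 * ((B * m t) * u t)"
      using B(2)[of t] u_pos[of t] p by (intro mult_left_mono mult_right_mono) auto
    also have "\<dots> = 4 * p * (p - 1) * (h t)\<^sup>2 * B * (m t * u t)"
      by (simp add: mult_ac)
    also have "\<dots> \<le> 4 * p * (p - 1) * (h t)\<^sup>2 * B * (2 * \<eta> t)"
      using mu p B(1) by (intro mult_left_mono) auto
    finally have "c * (x powr p - y powr p - p * y powr (p - 1) * (x - y))
        \<le> c * (4 * p * (p - 1) * (h t)\<^sup>2 * B * (2 * \<eta> t))"
      using c by (intro mult_left_mono) auto
    also have "\<dots> = (c * (8 * p * (p - 1) * B)) * (\<eta> t * (h t)\<^sup>2)"
      by (simp add: mult_ac)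
    also have "\<dots> \<le> \<delta> * (\<eta> t * (h t)\<^sup>2)"
    proof (intro mult_right_mono)
      have P: "8 * p * (p - 1) * B > 0" using p B(1) by simp
      have "c \<le> \<delta> / (8 * p * (p - 1) * B)" by (simp add: c_def)
      then show "c * (8 * p * (p - 1) * B) \<le> \<delta>" using P by (simp only: pos_le_divide_eq)
    qed (use \<eta>_pos[of t] in simp)
    finally show ?thesis by (simp add: mult_ac)
  qed
  have "c * (u (Suc t) powr p - u t powr p - p * u t powr (p - 1) * (u (Suc t) - u t))
      \<le> w (Suc t) - w t - m t * (u (Suc t) - u t)" for t
  proof -
    have "\<eta> t * (\<delta> * (h t)\<^sup>2) \<le> \<eta> t * (h t * (2 + h t) / 2 * step_width (h t) - convexity_gap (h t))"
      using margins_at(2)[of t] \<eta>_pos[of t] by (intro mult_left_mono) auto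
    also note upper_gap[of t]
    finally show ?thesis using Bregman[of "u (Suc t)" t "u t"] by linarith
  qed
  moreover have "c * (u t powr p - u (Suc t) powr p - p * u (Suc t) powr (p - 1) * (u t - u (Suc t)))
      \<le> w t - w (Suc t) - m (Suc t) * (u t - u (Suc t))" for t
  proof -
    have "\<eta> t * (\<delta> * (h t)\<^sup>2) \<le> \<eta> t * convexity_gap (h t)"
      using margins_at(1)[of t] \<eta>_pos[of t] by (intro mult_left_mono) auto
    then show ?thesis using Bregman[of "u t" t "u (Suc t)"] lower_gap[of t] by linarith
  qed
  ultimately show ?thesis using c slope by blast
qed

lemma m_lim: "m \<longlonglongrightarrow> 0"
proof -
  have "(\<lambda>t. sqrt k * \<tau> t powr (- (1/2))) \<longlonglongrightarrow> sqrt k * 0"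
    by (intro tendsto_mult tendsto_const \<tau>_powr_lim) auto
  moreover have "sqrt k * \<tau> t powr (- (1/2)) = m t" for t
    using \<tau>_pos[of t] by (simp add: m_def real_sqrt_divide powr_minus powr_half_sqrt inverse_eq_divide)
  ultimately show ?thesis by simp
qed

lemma orbit_asymptotics:
  assumes l: "(\<lambda>t. \<xi> t * \<tau> t powr (2 * k)) \<longlonglongrightarrow> l"
  shows "(\<lambda>T. (\<xi> T)\<^sup>2 * (1 + (m T)\<^sup>2) * real T powr (p / (p - 1))) \<longlonglongrightarrow> l\<^sup>2"
proof -
  define r where "r = p / (p - 1)"
  have "4 * (p / (4 * q)) = p / q" for q :: real by simp
  then have "4 * k = r" unfolding r_def k .
  then have r: "r = 2 * k + 2 * k" by simp
  have ratio: "(\<lambda>T. (real T / \<tau> T) powr r) \<longlonglongrightarrow> 1 powr r"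
  proof (rule tendsto_powr)
    show "(\<lambda>T. real T / \<tau> T) \<longlonglongrightarrow> 1" unfolding \<tau>_def by real_asymp
  qed auto
  have "(\<lambda>T. (\<xi> T * \<tau> T powr (2 * k))\<^sup>2 * (1 + (m T)\<^sup>2) * (real T / \<tau> T) powr r)
      \<longlonglongrightarrow> l\<^sup>2 * (1 + 0\<^sup>2) * 1 powr r"
    by (intro tendsto_mult tendsto_power tendsto_add tendsto_const l m_lim ratio)
  moreover have "(\<xi> T * \<tau> T powr (2 * k))\<^sup>2 * (1 + (m T)\<^sup>2) * (real T / \<tau> T) powr r
      = (\<xi> T)\<^sup>2 * (1 + (m T)\<^sup>2) * real T powr r" for T
  proof -
    have "(\<tau> T powr (2 * k))\<^sup>2 = \<tau> T powr r"
      by (simp only: r powr_add power2_eq_square)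
    moreover have "\<tau> T powr r * (real T / \<tau> T) powr r = real T powr r"
      using \<tau>_pos[of T] by (simp add: powr_divide)
    ultimately have eq: "(\<tau> T powr (2 * k))\<^sup>2 * (real T / \<tau> T) powr r = real T powr r" by simp
    have "(\<xi> T * \<tau> T powr (2 * k))\<^sup>2 * (1 + (m T)\<^sup>2) * (real T / \<tau> T) powr r
      = (\<xi> T)\<^sup>2 * (1 + (m T)\<^sup>2) * ((\<tau> T powr (2 * k))\<^sup>2 * (real T / \<tau> T) powr r)"
      by (simp only: power_mult_distrib mult_ac)
    then show ?thesis by (simp only: eq)
  qed
  ultimately have "(\<lambda>T. (\<xi> T)\<^sup>2 * (1 + (m T)\<^sup>2) * real T powr r) \<longlonglongrightarrow> l\<^sup>2 * (1 + 0\<^sup>2) * 1 powr r"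
    by (simp only:)
  then show ?thesis by (simp add: r_def)
qed

end

lemma (in zigzag_exponents) exists_zigzag_sequences: "\<exists>N \<delta>. zigzag_sequences p k a b N \<delta>"
proof -
  define \<delta> where "\<delta> = p / (4 * (p\<^sup>2 - 1))"
  have "1 < p\<^sup>2" using p by (simp add: one_less_power)
  then have \<delta>: "\<delta> > 0" using p by (simp add: \<delta>_def)
  have "filterlim (\<lambda>n::real. sqrt (1 + 1 / n) - 1) (at_right 0) at_top"
    by real_asymp
  from eventually_compose_filterlim[OF eventually_margins this]
  obtain n0 where n0: "\<And>n. n \<ge> n0 \<Longrightarrow> (\<lambda>h. \<delta> * h\<^sup>2 \<le> convexity_gap h \<and> \<delta> * h\<^sup>2 \<le> h * (2 + h) / 2 * step_width h - convexity_gap h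
    \<and> 0 < step_width h \<and> step_width h \<le> h \<and> 1/2 \<le> share h \<and> share h \<le> 1) (sqrt (1 + 1 / n) - 1)"
    unfolding eventually_at_top_linorder \<delta>_def by blast
  define N where "N = max 2 (nat \<lceil>n0\<rceil>)"
  have "n0 \<le> real N" unfolding N_def by linarith
  then have "zigzag_sequences p k a b N \<delta>"
    using n0 \<delta> by unfold_locales (auto simp: N_def)
  then show ?thesis by blast
qed

text \<open>
  The reciprocals converge, hence they are bounded.
\<close>

lemma positive_limit_imp_positive_lower_bound:
  fixes q :: "nat \<Rightarrow> real"
  assumes "q \<longlonglongrightarrow> l" "l > 0" "\<And>n. q n > 0"
  shows "\<exists>c>0. \<forall>n. c \<le> q n"
proof -
  have "(\<lambda>n. inverse (q n)) \<longlonglongrightarrow> inverse l"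
    using assms by (intro tendsto_inverse) auto
  then have "Bseq (\<lambda>n. inverse (q n))"
    by (auto intro: convergent_imp_Bseq convergentI)
  then obtain B where B: "B > 0" "\<And>n. norm (inverse (q n)) \<le> B"
    by (auto elim: BseqE)
  have "inverse B \<le> q n" for n
    using B(2)[of n] B(1) assms(3)[of n] by (simp add: field_simps)
  then show ?thesis using B(1) by (intro exI[of _ "inverse B"]) auto
qed

theorem theorem4:
  fixes p :: real
  assumes "p \<ge> 3" and "CARD('d::finite) \<ge> 2"
  shows "\<exists>(C :: (real ^ 'd) set) (f :: real ^ 'd \<Rightarrow> real) xs x0.
    compact C \<and> convex C \<and> power_uniformly_convex_set p C \<and>
    smooth_fun_on C f \<and> strongly_convex_fun_on C f \<and>
    is_arg_min f (\<lambda>y. y \<in> C) xs \<and> x0 \<in> C \<and>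
    (\<exists>x. frank_wolfe_line_search C f x0 x) \<and>
    (\<forall>x. frank_wolfe_line_search C f x0 x \<longrightarrow>
      (\<lambda>T. f (x T) - f xs) \<sim>[at_top]
        (\<lambda>T. ((p + 1) / p)\<^sup>2 * (p / (4 * (p - 1))) powr (p / (p - 1))
               * real T powr (- (p / (p - 1)))) \<and>
      (\<exists>c>0. \<forall>T\<ge>1. f (x T) - f xs \<ge> c * real T powr (- (p / (p - 1)))))"
proof -
  define k where "k = p / (4 * (p - 1))"
  define a where "a = p / (p + 1)"
  define b where "b = - p / (4 * (5 * p - 3))"
  have "zigzag_exponents p k a b"
    using assms(1) by unfold_locales (auto simp: k_def a_def b_def)
  from zigzag_exponents.exists_zigzag_sequences[OF this]
  obtain N \<delta> where "zigzag_sequences p k a b N \<delta>" by blast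
  then interpret seq: zigzag_sequences p k a b N \<delta> .
  obtain i j :: 'd where "i \<noteq> j"
    using assms(2) by (metis (full_types) UNIV_I card_2_iff' card_le_Suc0_iff_eq finite_class.finite_UNIV
        not_less_eq_eq numeral_2_eq_2)
  then interpret orthonormal_pair "axis i 1 :: real ^ 'd" "axis j 1"
    by unfold_locales (auto simp: norm_axis_1 inner_axis_axis)
  obtain l where l: "l > 0" "(\<lambda>t. seq.\<xi> t * seq.\<tau> t powr (2 * k)) \<longlonglongrightarrow> l"
    using seq.\<xi>_asymptotics by blast
  define r where "r = p / (p - 1)"
  define M where "M = ((p + 1) / p)\<^sup>2 * (p / (4 * (p - 1))) powr r"
  have M: "M > 0" using assms(1) by (auto simp: M_def)
  \<comment> \<open>Rescaling the objective leaves the orbit unchanged and adjusts the constant of the rate.\<close>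
  define K where "K = M / l\<^sup>2"
  have K: "K > 0" using M l(1) by (simp add: K_def)
  define f where "f = (\<lambda>z :: real ^ 'd. K * (norm z)\<^sup>2)"
  define X where "X = (\<lambda>t. seq.\<xi> t *\<^sub>R pt ((-1) ^ t * seq.m t) 1)"
  obtain c where c: "c > 0"
    "\<And>t. c * (p * seq.u t powr (p - 1)) \<le> seq.m t"
    "\<And>t. c * (seq.u (Suc t) powr p - seq.u t powr p - p * seq.u t powr (p - 1) * (seq.u (Suc t) - seq.u t))
      \<le> seq.w (Suc t) - seq.w t - seq.m t * (seq.u (Suc t) - seq.u t)"
    "\<And>t. c * (seq.u t powr p - seq.u (Suc t) powr p - p * seq.u (Suc t) powr (p - 1) * (seq.u t - seq.u (Suc t)))
      \<le> seq.w t - seq.w (Suc t) - seq.m (Suc t) * (seq.u t - seq.u (Suc t))"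
    using seq.uniform_convexity_margin by blast
  have "p \<ge> 2" using assms(1) by simp
  then obtain C where C: "compact C" "convex C" "power_uniformly_convex_set p C" "0 \<in> C" "X 0 \<in> C"
    and run: "\<And>x. frank_wolfe_line_search C f (X 0) x \<longleftrightarrow> x = X"
    using exists_zigzag_set[of p K seq.m seq.\<xi> seq.u seq.w c, OF \<open>p \<ge> 2\<close> K seq.m_pos seq.m_le seq.\<xi>_pos seq.u_pos seq.u_dec seq.u_lim seq.w_lim
        seq.foot[unfolded seq.\<eta>_def] seq.line[unfolded seq.\<eta>_def] seq.inside c]
    unfolding X_def f_def by blast
  have fX: "f (X T) = K * ((seq.\<xi> T)\<^sup>2 * (1 + (seq.m T)\<^sup>2))" for T
    by (simp add: f_def X_def scaleR_pt norm_pt power_mult_distrib distrib_left mult_ac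
        flip: power_mult)
  have fX_pos: "f (X T) > 0" for T
    unfolding fX using K seq.\<xi>_pos[of T] by (intro mult_pos_pos add_pos_nonneg) auto
  have f0: "f 0 = 0" by (simp add: f_def)
  have lim: "(\<lambda>T. f (X T) * real T powr r) \<longlonglongrightarrow> M"
  proof -
    have "(\<lambda>T. K * ((seq.\<xi> T)\<^sup>2 * (1 + (seq.m T)\<^sup>2) * real T powr r)) \<longlonglongrightarrow> K * l\<^sup>2"
      unfolding r_def by (intro tendsto_intros seq.orbit_asymptotics l)
    moreover have "K * l\<^sup>2 = M" using l(1) by (simp add: K_def)
    ultimately show ?thesis by (simp add: fX mult.assoc)
  qed
  have asymp: "(\<lambda>T. f (X T)) \<sim>[at_top] (\<lambda>T. M * real T powr (- r))"
  proof (rule asymp_equivI')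
    have "(\<lambda>T. f (X T) * real T powr r / M) \<longlonglongrightarrow> M / M"
      using M by (intro tendsto_intros lim) auto
    then show "(\<lambda>T. f (X T) / (M * real T powr (- r))) \<longlonglongrightarrow> 1"
      using M by (simp add: powr_minus divide_inverse mult_ac)
  qed
  have "\<exists>c>0. \<forall>T. c \<le> f (X (Suc T)) * real (Suc T) powr r"
  proof (rule positive_limit_imp_positive_lower_bound)
    show "(\<lambda>T. f (X (Suc T)) * real (Suc T) powr r) \<longlonglongrightarrow> M"
      using LIMSEQ_Suc[OF lim] .
  qed (use M fX_pos in auto)
  then obtain c' where c': "c' > 0" "\<And>T. c' \<le> f (X (Suc T)) * real (Suc T) powr r" by blast
  have lower: "f (X T) \<ge> c' * real T powr (- r)" if T: "T \<ge> 1" for T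
  proof -
    obtain S where "T = Suc S" using T by (cases T) auto
    then have "c' \<le> f (X T) * real T powr r" "0 < real T powr r" using c'(2)[of S] by auto
    then show ?thesis by (simp add: powr_minus field_simps)
  qed
  have "is_arg_min f (\<lambda>y. y \<in> C) 0"
    using C(4) K by (auto simp: is_arg_min_def f_def not_less)
  moreover have "smooth_fun_on C f" "strongly_convex_fun_on C f"
    unfolding f_def by (rule smooth_strongly_convex_norm_sq[OF K])+
  ultimately show ?thesis
    using C run asymp lower c'(1) unfolding M_def r_def
    by (intro exI[of _ C] exI[of _ f] exI[of _ 0] exI[of _ "X 0"]) (auto simp: f0)
qed

end
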